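(* Suppose that the discrete-time robust control contraction metric condition (RCCM) and the terminal condition (TERM) hold, and that the proportional error bound (PEB) is valid. Let $\{\bar x^*_{i|k},\bar u^*_{i|k},\delta^*_{i|k}\mid i\in\{0,\dots,N\}\}$ be the solution returned at time $k$ by the online algorithm (ALG), with the resulting closed loop $x(k+1)=F(x(k),u(k))$, $u(k)=\kappa(x(k),\bar x^*_{0|k},\bar u^*_{0|k})$. If the tube MPC problem $\mathcal P(x(k))$ is feasible at time $k=0$, then $\mathcal P(x(k))$ is feasible for all $k\ge0$. Moreover, $$\lim_{k\to\infty}\bar x^*_{0|k}=0_{n_x},\qquad \lim_{k\to\infty}\bar u^*_{0|k}=0_{n_u},\qquad \lim_{k\to\infty}\delta^*_{0|k}=0.$$
   Context: Notation: $\|\cdot\|$ is the Euclidean norm, $\|y\|_P=\sqrt{y^\top P y}$, $\mathcal B(y,r)$ is the closed ball, $\otimes$ the Kronecker product, $\preceq$ the Loewner order, $\mathbb S_+^n$ the symmetric positive definite $n\times n$ matrices, $\|\cdot\|_F$ the Frobenius norm; $P^{1/2}$ is the Cholesky factor with $P=(P^{1/2})^\top P^{1/2}$ and $P^{-1/2}$ its inverse. System. $\mathbb X\subset\mathbb R^{n_x}$ and $\mathbb U\subset\mathbb R^{n_u}$ are compact, and $\mathbb U$ contains the standard basis vectors $e_1,\dots,e_{n_u}$. The true system is $\dot x=f(x)+g(x)u$ with $f(0)=0$; $x(t;\hat x,u)$ is its solution at time $t$ from $\hat x$ under constant input $u$ (provided it exists), $T_s>0$ is fixed, and $F(x,u)=x(T_s;x,u)$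 is the sampled true map. The constraint set $\mathcal Z=\{(x,u)\in\mathbb R^{n_x}\times\mathbb R^{n_u}\mid h_j(x,u)\le0,\ j=1,\dots,n_h\}\subseteq\mathbb X\times\mathbb U$ is compact, each $h_j$ is continuously differentiable and $h_j(0,0)<0$. Learned model. $\hat\Phi(x)=[x^\top\ \phi_{n_x+1}(x)\cdots\phi_{n_z}(x)]^\top\in\mathbb R^{n_z}$, $n_z>n_x$, with continuously differentiable $\phi_\ell:\mathbb R^{n_x}\to\mathbb R$, $\phi_\ell(0)=0$. From data $y_j^{\tilde u}=F(x_j^{\tilde u},\tilde u)$, $j=1,\dots,d$, $\tilde u\in\{0,e_1,\dots,e_{n_u}\}$, the matrices $A,B_i\in\mathbb R^{n_z\times n_z}$ and $b_i\in\mathbb R^{n_z}$ are least-squares fits: $A$ minimizes $\|[\hat\Phi(y_1^0)\cdots\hat\Phi(y_d^0)]-A[\hat\Phi(x_1^0)\cdots\hat\Phi(x_d^0)]\|_F$, and $[b_i\ B_i]$ minimizes $\|[\hat\Phi(y_1^{e_i})\cdots\hat\Phi(y_d^{e_i})]-[b_i\ B_i][\Phi(x_1^{e_i})\cdots\Phi(x_d^{e_i})]\|_F$ with $\Phi=[1\ \hat\Phi^\top]^\top$. Put $B_0=[b_1\cdots b_{n_u}]$, $\mathcal L(x,u)=A\hat\Phi(x)+B_0u+\sum_{i=1}^{n_u}(B_i-A)u_i\hat\Phi(x)$, $\xi(x,u)=\hat\Phi(F(x,u))-\mathcal L(x,u)$, and $\hat F(x,u)=[I_{n_x}\ 0_{n_x\times(n_z-n_x)}]\,\mathcal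 L(x,u)$. (PEB) with constants $c_x,c_u\ge0$: $\|\xi(x,u)\|\le c_x\|\hat\Phi(x)\|+c_u\|u\|$ for all $x\in\mathbb X$, $u\in\mathbb U$. Uncertain predictor. $E(x,u)=[c_x(\hat\Phi(x)^\top\otimes I_{n_x})\ \ c_u(u^\top\otimes I_{n_x})]$; $\mathbb D$ is the set of vectors $\begin{bmatrix}w_\Phi\otimes w_x\\ w_u\otimes w_x\end{bmatrix}$ with $w_\Phi\in\mathcal B(0_{n_z},1)$, $w_u\in\mathcal B(0_{n_u},1)$, $w_x\in\mathcal B(0_{n_x},1)$; and $f_w(x,u,w)=\hat F(x,u)+E(x,u)w$. (RCCM): $M:\mathbb R^{n_x}\to\mathbb S_+^{n_x}$ is continuously differentiable, $K:\mathbb R^{n_x}\to\mathbb R^{n_u\times n_x}$ is continuous, $0<\rho_c<1$, $\alpha_1,\alpha_2>0$, and for all $(x,u)\in\mathcal Z$, $w\in\mathbb D$, with $x_+=f_w(x,u,w)$ and $A_{cl}(x,u,w)=\frac{\partial f_w}{\partial x}(x,u,w)+\frac{\partial f_w}{\partial u}(x,u,w)K(x)$: $A_{cl}^\top M(x_+)A_{cl}\preceq(1-\rho_c)M(x)$, $\alpha_1I\preceq M(x)\preceq\alpha_2I$, and $M(x_+)\preceq\alpha_2I$. Distance and feedback. $\Gamma(\bar x,x)$ is the set of componentwise continuously differentiable curves $\gamma:[0,1]\to\mathbb R^{n_x}$ with $\gamma(0)=\bar x$, $\gamma(1)=x$. $V(x,\bar x)=\min_{\gamma\in\Gamma(\bar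 x,x)}\int_0^1\|\dot\gamma(s)\|_{M(\gamma(s))}ds$ is the Riemannian distance, $\gamma^*$ denotes a minimizer (geodesic, taken to exist). $\gamma^u(s)=\bar u+\int_0^sK(\gamma^*(s'))\dot\gamma^*(s')ds'$ and $\kappa(x,\bar x,\bar u)=\gamma^u(1)$. Tightening constants: $c_j=\max_{(x,u)\in\mathcal Z}\|(\frac{\partial h_j}{\partial x}(x,u)+\frac{\partial h_j}{\partial u}(x,u)K(x))M(x)^{-1/2}\|$. Stage cost: $\ell(\bar x,\bar u,\delta)=\|\bar x\|_Q^2+\|\bar u\|_R^2+\lambda\delta^2$, $Q\in\mathbb S_+^{n_x}$, $R\in\mathbb S_+^{n_u}$, $\lambda>0$. (TERM): there are $\mathcal X_f\subseteq\mathbb R^{n_x}\times\mathbb R_{\ge0}$, $k_f:\mathbb R^{n_x}\to\mathbb R^{n_u}$, $\ell_f:\mathbb R^{n_x}\times\mathbb R_{\ge0}\to\mathbb R_{\ge0}$ such that for every $(\bar x,\delta)\in\mathcal X_f$ and all $j$, with $\bar x_+=\hat F(\bar x,k_f(\bar x))$ and $\delta_+=\sqrt{1-\rho_c}\,\delta+\sqrt{\alpha_2}(c_x\|\hat\Phi(\bar x)\|+c_u\|k_f(\bar x)\|)$: $(\bar x_+,\delta_+)\in\mathcal X_f$; $h_j(\bar x,k_f(\bar x))+c_j\delta\le0$ and $h_j(\bar x_+,k_f(\bar x_+))+c_j\delta_+\le0$; $\ell(\bar x,k_f(\bar x),\delta)\le\ell_f(\bar x,\delta)-\ell_f(\bar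 x_+,\delta_+)$; and for $\hat\delta\in[0,\delta]$, $(\bar x,\hat\delta)\in\mathcal X_f$ and $\ell_f(\bar x,\hat\delta)\le\ell_f(\bar x,\delta)$. Tube MPC problem $\mathcal P(x(k))$ (horizon $N$): minimize $\sum_{i=0}^{N-1}\ell(\bar x_{i|k},\bar u_{i|k},\delta_{i|k})+\ell_f(\bar x_{N|k},\delta_{N|k})$ over $\bar x_{\cdot|k},\bar u_{\cdot|k},\delta_{\cdot|k}$ subject to, for $i=0,\dots,N-1$ and $j=1,\dots,n_h$: $\bar x_{i+1|k}=\hat F(\bar x_{i|k},\bar u_{i|k})$; $\delta_{i+1|k}=\sqrt{1-\rho_c}\,\delta_{i|k}+\sqrt{\alpha_2}(c_x\|\hat\Phi(\bar x_{i|k})\|+c_u\|\bar u_{i|k}\|)$; $h_j(\bar x_{i|k},\bar u_{i|k})+c_j\delta_{i|k}\le0$; $V(x(k),\bar x_{0|k})=\delta_{0|k}$; $(\bar x_{N|k},\delta_{N|k})\in\mathcal X_f$. (ALG) At each time $k$: the candidate is initialized as some feasible solution of $\mathcal P(x(0))$ if $k=0$, and as the shifted previous solution if $k\ge1$; a numerical solver is run on $\mathcal P(x(k))$ for a limited time, and if it finds a feasible solution with smaller cost the candidate is replaced by it (no optimality is required); then, if the local solution $\bar x_{i|k}=0$, $\bar u_{i|k}=0$, $\delta_{i|k}=(\sqrt{1-\rho_c})^iV(x(k),0)$, $i=0,\dots,N$, is feasible and has smaller cost, the candidate is replaced by it. The resulting candidate is the returned solution (denoted with $*$), and $u(k)=\kappa(x(k),\bar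 x^*_{0|k},\bar u^*_{0|k})$ is applied. The shifted previous solution at time $k+1$ is: $\bar x_{0|k+1}=\bar x^*_{1|k}$, $\delta_{0|k+1}=V(x(k+1),\bar x_{0|k+1})$, $\bar u_{i|k+1}=\bar u^*_{i+1|k}$ for $i=0,\dots,N-1$, where $\bar u^*_{N|k}:=k_f(\bar x^*_{N|k})$, with the remaining $\bar x_{i|k+1},\delta_{i|k+1}$ given by the two recursions of $\mathcal P$.
   Formalization: Added assumption: if c_j = 0, then at each (x,u) in Z with h_j(x,u) = 0 the row ∂h_j/∂x + (∂h_j/∂u)K vanishes in a neighbourhood (vacuous when c_j > 0). Without it the claim fails: the tube may leave Z, where (RCCM) gives nothing. *)

theory Defs
  imports "HOL-Analysis.Analysis"
begin

section \<open>Matrices and calculus\<close>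

text \<open>The notation \<open>real^'n\<close> forces the sort \<^class>\<open>finite\<close> on a bare index variable; these
  synonyms admit larger sorts. The first index of \<open>rmat\<close> is the row index.\<close>

type_synonym 'n rvec = "(real, 'n) vec"
type_synonym ('m, 'n) rmat = "((real, 'n) vec, 'm) vec"

definition posdef :: "real^'n^'n \<Rightarrow> bool" where
  "posdef P \<longleftrightarrow> transpose P = P \<and> (\<forall>v. v \<noteq> 0 \<longrightarrow> v \<bullet> (P *v v) > 0)"

definition loewner_le :: "real^'n^'n \<Rightarrow> real^'n^'n \<Rightarrow> bool" where
  "loewner_le P R \<longleftrightarrow> (\<forall>v. v \<bullet> (P *v v) \<le> v \<bullet> (R *v v))"

definition wnorm :: "real^'n^'n \<Rightarrow> real^'n \<Rightarrow> real" where
  "wnorm P y = sqrt (y \<bullet> (P *v y))"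

definition cholesky :: "('n::{finite,linorder}, 'n) rmat \<Rightarrow> ('n, 'n) rmat" where
  "cholesky P = (THE R. (\<forall>i j. j < i \<longrightarrow> R $ i $ j = 0) \<and> (\<forall>i. R $ i $ i > 0) \<and>
     transpose R ** R = P)"

text \<open>Kronecker products are indexed by pairs (left factor first); stacked vectors and
  horizontal block matrices are indexed by sum types.\<close>

definition vec_kron :: "real^'m \<Rightarrow> real^'n \<Rightarrow> real^('m \<times> 'n)" where
  "vec_kron v w = (\<chi> p. v $ fst p * w $ snd p)"

text \<open>The product of the row vector \<open>v\<^sup>T\<close> with the matrix \<open>P\<close>.\<close>

definition row_kron :: "real^'m \<Rightarrow> real^'n^'k \<Rightarrow> real^('m \<times> 'n)^'k" where
  "row_kron v P = (\<chi> i p. v $ fst p * P $ i $ snd p)"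

definition stack :: "real^'m \<Rightarrow> real^'n \<Rightarrow> real^('m + 'n)" where
  "stack v w = (\<chi> c. case c of Inl a \<Rightarrow> v $ a | Inr b \<Rightarrow> w $ b)"

definition hcat :: "real^'m^'k \<Rightarrow> real^'n^'k \<Rightarrow> real^('m + 'n)^'k" where
  "hcat P R = (\<chi> i. stack (P $ i) (R $ i))"

definition mat_of_cols :: "('d \<Rightarrow> real^'n) \<Rightarrow> real^'d^'n" where
  "mat_of_cols c = (\<chi> i j. c j $ i)"

text \<open>A single column is a matrix with column index type \<^typ>\<open>unit\<close>.\<close>

definition col_mat :: "real^'n \<Rightarrow> real^unit^'n" where
  "col_mat v = mat_of_cols (\<lambda>_. v)"

definition C1 :: "('a::real_normed_vector \<Rightarrow> 'b::real_normed_vector) \<Rightarrow> bool" where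
  "C1 \<psi> \<longleftrightarrow> (\<exists>D. (\<forall>x. (\<psi> has_derivative blinfun_apply (D x)) (at x)) \<and> continuous_on UNIV D)"

definition grad :: "(real^'n \<Rightarrow> real) \<Rightarrow> real^'n \<Rightarrow> real^'n" where
  "grad \<psi> x = (\<chi> i. frechet_derivative \<psi> (at x) (axis i 1))"

text \<open>\<open>curves a b\<close> is the set of continuously differentiable curves on the unit interval from
  \<open>a\<close> to \<open>b\<close>, with one-sided derivatives at the end points.\<close>

definition curves :: "real^'n \<Rightarrow> real^'n \<Rightarrow> (real \<Rightarrow> real^'n) set" where
  "curves a b = {\<gamma>. \<gamma> 0 = a \<and> \<gamma> 1 = b \<and>
     (\<exists>D. (\<forall>s\<in>{0..1}. (\<gamma> has_vector_derivative D s) (at s within {0..1})) \<and>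
        continuous_on {0..1} D)}"

definition cdot :: "(real \<Rightarrow> real^'n) \<Rightarrow> real \<Rightarrow> real^'n" where
  "cdot \<gamma> s = vector_derivative \<gamma> (at s within {0..1})"


section \<open>Problem data\<close>

text \<open>The lifted state space is indexed by \<open>'nx + 'ne\<close>, so that \<open>n\<^sub>z > n\<^sub>x\<close> holds because
  types are nonempty; \<open>'nc\<close> indexes the constraints and \<open>'d\<close> the data points. The linear order on
  \<open>'nx\<close> is used for the triangular shape of the Cholesky factor only.

  \<open>sol x u t\<close> is the solution of the true system at time \<open>t\<close>, and \<open>geo a b\<close> is the chosen geodesic
  from \<open>a\<close> to \<open>b\<close>.\<close>

record ('nx::"{finite,linorder}", 'ne::finite, 'nu::finite, 'nc::finite, 'd::finite) mpc =
  state_set :: "'nx rvec set"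
  input_set :: "'nu rvec set"
  drift :: "'nx rvec \<Rightarrow> 'nx rvec"
  input_map :: "'nx rvec \<Rightarrow> ('nx, 'nu) rmat"
  samp_time :: real
  sol :: "'nx rvec \<Rightarrow> 'nu rvec \<Rightarrow> real \<Rightarrow> 'nx rvec"
  constr :: "'nc \<Rightarrow> 'nx rvec \<Rightarrow> 'nu rvec \<Rightarrow> real"
  feature :: "'ne \<Rightarrow> 'nx rvec \<Rightarrow> real"
  x_data :: "'nu rvec \<Rightarrow> 'd \<Rightarrow> 'nx rvec"
  A_mat :: "real^('nx + 'ne)^('nx + 'ne)"
  B_mat :: "'nu \<Rightarrow> real^('nx + 'ne)^('nx + 'ne)"
  b_vec :: "'nu \<Rightarrow> real^('nx + 'ne)"
  c_x :: real
  c_u :: real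
  metric :: "'nx rvec \<Rightarrow> ('nx, 'nx) rmat"
  gain :: "'nx rvec \<Rightarrow> ('nu, 'nx) rmat"
  rho_c :: real
  alpha1 :: real
  alpha2 :: real
  geo :: "'nx rvec \<Rightarrow> 'nx rvec \<Rightarrow> real \<Rightarrow> 'nx rvec"
  Q_mat :: "('nx, 'nx) rmat"
  R_mat :: "('nu, 'nu) rmat"
  lam :: real
  term_set :: "('nx rvec \<times> real) set"
  k_f :: "'nx rvec \<Rightarrow> 'nu rvec"
  l_f :: "'nx rvec \<Rightarrow> real \<Rightarrow> real"
  horizon :: nat

text \<open>A candidate for the tube MPC problem. Only the entries \<open>i \<le> N\<close> of the nominal states and tube
  sizes and the entries \<open>i < N\<close> of the nominal inputs are meaningful.\<close>

record ('nx::finite, 'nu::finite) plan =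
  xbar :: "nat \<Rightarrow> 'nx rvec"
  ubar :: "nat \<Rightarrow> 'nu rvec"
  tube :: "nat \<Rightarrow> real"

context
  fixes S :: "('nx::{finite,linorder}, 'ne::finite, 'nu::finite, 'nc::finite, 'd::finite) mpc"
begin

subsection \<open>True system\<close>

definition trajectory :: "'nx rvec \<Rightarrow> 'nu rvec \<Rightarrow> (real \<Rightarrow> 'nx rvec) \<Rightarrow> bool" where
  "trajectory x u y \<longleftrightarrow> y 0 = x \<and>
     (\<forall>t\<in>{0..samp_time S}. (y has_vector_derivative (drift S (y t) + input_map S (y t) *v u))
        (at t within {0..samp_time S}))"

definition sol_exists :: "'nx rvec \<Rightarrow> 'nu rvec \<Rightarrow> bool" where
  "sol_exists x u \<longleftrightarrow> (\<exists>y. trajectory x u y)"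

definition F_true :: "'nx rvec \<Rightarrow> 'nu rvec \<Rightarrow> 'nx rvec" where
  "F_true x u = sol S x u (samp_time S)"

definition Z_set :: "('nx rvec \<times> 'nu rvec) set" where
  "Z_set = {(x, u). \<forall>j. constr S j x u \<le> 0}"

definition true_system :: bool where
  "true_system \<longleftrightarrow>
     compact (state_set S) \<and> compact (input_set S) \<and> (\<forall>i. axis i 1 \<in> input_set S) \<and>
     drift S 0 = 0 \<and> samp_time S > 0 \<and>
     (\<forall>x u. sol_exists x u \<longrightarrow> trajectory x u (sol S x u)) \<and>
     compact Z_set \<and> Z_set \<subseteq> state_set S \<times> input_set S \<and>
     (\<forall>j. C1 (\<lambda>p. constr S j (fst p) (snd p)) \<and> constr S j 0 0 < 0)"

subsection \<open>Learned model\<close>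

definition Phi_hat :: "'nx rvec \<Rightarrow> real^('nx + 'ne)" where
  "Phi_hat x = stack x (\<chi> l. feature S l x)"

definition Phi :: "'nx rvec \<Rightarrow> real^(unit + ('nx + 'ne))" where
  "Phi x = stack 1 (Phi_hat x)"

text \<open>The norm of a matrix of type \<open>real^'d^'n\<close> is its Frobenius norm.\<close>

definition least_squares_fit :: bool where
  "least_squares_fit \<longleftrightarrow>
     (\<forall>v \<in> insert 0 (range (\<lambda>i. axis i 1)). \<forall>j. sol_exists (x_data S v j) v) \<and>
     is_arg_min
       (\<lambda>P. norm (mat_of_cols (\<lambda>j. Phi_hat (F_true (x_data S 0 j) 0))
                  - P ** mat_of_cols (\<lambda>j. Phi_hat (x_data S 0 j))))
       (\<lambda>_. True) (A_mat S) \<and>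
     (\<forall>i. is_arg_min
       (\<lambda>P. norm (mat_of_cols (\<lambda>j. Phi_hat (F_true (x_data S (axis i 1) j) (axis i 1)))
                  - P ** mat_of_cols (\<lambda>j. Phi (x_data S (axis i 1) j))))
       (\<lambda>_. True) (hcat (col_mat (b_vec S i)) (B_mat S i)))"

definition learned_model :: bool where
  "learned_model \<longleftrightarrow> (\<forall>l. C1 (feature S l) \<and> feature S l 0 = 0) \<and> least_squares_fit"

definition B0 :: "real^'nu^('nx + 'ne)" where
  "B0 = mat_of_cols (b_vec S)"

definition lifted_pred :: "'nx rvec \<Rightarrow> 'nu rvec \<Rightarrow> real^('nx + 'ne)" where
  "lifted_pred x u = A_mat S *v Phi_hat x + B0 *v u
     + (\<Sum>i\<in>UNIV. (B_mat S i - A_mat S) *v (u $ i *\<^sub>R Phi_hat x))"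

definition model_error :: "'nx rvec \<Rightarrow> 'nu rvec \<Rightarrow> real^('nx + 'ne)" where
  "model_error x u = Phi_hat (F_true x u) - lifted_pred x u"

definition F_hat :: "'nx rvec \<Rightarrow> 'nu rvec \<Rightarrow> 'nx rvec" where
  "F_hat x u = hcat (mat 1) 0 *v lifted_pred x u"

definition PEB :: bool where
  "PEB \<longleftrightarrow> c_x S \<ge> 0 \<and> c_u S \<ge> 0 \<and>
     (\<forall>x\<in>state_set S. \<forall>u\<in>input_set S. sol_exists x u \<and>
        norm (model_error x u) \<le> c_x S * norm (Phi_hat x) + c_u S * norm u)"

subsection \<open>Uncertain predictor and contraction metric\<close>

definition E_mat :: "'nx rvec \<Rightarrow> 'nu rvec \<Rightarrow> ('nx, (('nx + 'ne) \<times> 'nx) + ('nu \<times> 'nx)) rmat" where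
  "E_mat x u = hcat (c_x S *\<^sub>R row_kron (Phi_hat x) (mat 1)) (c_u S *\<^sub>R row_kron u (mat 1))"

definition D_set :: "(real^((('nx + 'ne) \<times> 'nx) + ('nu \<times> 'nx))) set" where
  "D_set = {stack (vec_kron w\<^sub>\<Phi> w\<^sub>x) (vec_kron w\<^sub>u w\<^sub>x) | w\<^sub>\<Phi> w\<^sub>u w\<^sub>x.
     w\<^sub>\<Phi> \<in> cball 0 1 \<and> w\<^sub>u \<in> cball 0 1 \<and> w\<^sub>x \<in> cball 0 1}"

definition f_w :: "'nx rvec \<Rightarrow> 'nu rvec \<Rightarrow> real^((('nx + 'ne) \<times> 'nx) + ('nu \<times> 'nx)) \<Rightarrow> 'nx rvec" where
  "f_w x u w = F_hat x u + E_mat x u *v w"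

definition A_cl :: "'nx rvec \<Rightarrow> 'nu rvec \<Rightarrow> real^((('nx + 'ne) \<times> 'nx) + ('nu \<times> 'nx)) \<Rightarrow> ('nx, 'nx) rmat" where
  "A_cl x u w = jacobian (\<lambda>y. f_w y u w) (at x) + jacobian (\<lambda>v. f_w x v w) (at u) ** gain S x"

definition RCCM :: bool where
  "RCCM \<longleftrightarrow>
     (\<forall>x. posdef (metric S x)) \<and> C1 (metric S) \<and> continuous_on UNIV (gain S) \<and>
     0 < rho_c S \<and> rho_c S < 1 \<and> alpha1 S > 0 \<and> alpha2 S > 0 \<and>
     (\<forall>(x, u)\<in>Z_set. \<forall>w\<in>D_set.
        loewner_le (transpose (A_cl x u w) ** metric S (f_w x u w) ** A_cl x u w)
          ((1 - rho_c S) *\<^sub>R metric S x) \<and>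
        loewner_le (alpha1 S *\<^sub>R mat 1) (metric S x) \<and>
        loewner_le (metric S x) (alpha2 S *\<^sub>R mat 1) \<and>
        loewner_le (metric S (f_w x u w)) (alpha2 S *\<^sub>R mat 1))"

subsection \<open>Riemannian distance and feedback\<close>

definition curve_length :: "(real \<Rightarrow> 'nx rvec) \<Rightarrow> real" where
  "curve_length \<gamma> = integral {0..1} (\<lambda>s. wnorm (metric S (\<gamma> s)) (cdot \<gamma> s))"

text \<open>The infimum is attained under \<open>geodesics\<close> below.\<close>

definition V_dist :: "'nx rvec \<Rightarrow> 'nx rvec \<Rightarrow> real" where
  "V_dist x xb = (INF \<gamma>\<in>curves xb x. curve_length \<gamma>)"

definition geodesics :: bool where
  "geodesics \<longleftrightarrow> (\<forall>xb x. is_arg_min curve_length (\<lambda>\<gamma>. \<gamma> \<in> curves xb x) (geo S xb x))"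

definition gamma_u :: "'nx rvec \<Rightarrow> 'nx rvec \<Rightarrow> 'nu rvec \<Rightarrow> real \<Rightarrow> 'nu rvec" where
  "gamma_u x xb ub s =
     ub + integral {0..s} (\<lambda>s'. gain S (geo S xb x s') *v cdot (geo S xb x) s')"

definition kappa :: "'nx rvec \<Rightarrow> 'nx rvec \<Rightarrow> 'nu rvec \<Rightarrow> 'nu rvec" where
  "kappa x xb ub = gamma_u x xb ub 1"

subsection \<open>Constraint tightening\<close>

definition constr_grad :: "'nc \<Rightarrow> 'nx rvec \<Rightarrow> 'nu rvec \<Rightarrow> 'nx rvec" where
  "constr_grad j x u =
     grad (\<lambda>y. constr S j y u) x + grad (\<lambda>v. constr S j x v) u v* gain S x"

text \<open>The supremum is a maximum under the standing assumptions, as \<open>Z_set\<close> is compact and contains the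
  origin.\<close>

definition tight :: "'nc \<Rightarrow> real" where
  "tight j = (SUP (x, u)\<in>Z_set. norm (constr_grad j x u v* matrix_inv (cholesky (metric S x))))"

text \<open>If \<open>tight j = 0\<close>, then \<open>constr_grad j\<close> vanishes on \<open>Z_set\<close>, but a tube of positive size around
  a nominal point with \<open>constr S j x u = 0\<close> may leave \<open>Z_set\<close>, for instance if
  \<open>constr S j x u = (x - 2)\<^sup>2\<close> near \<open>x = 2\<close> and the gain is zero. The next condition excludes
  this. It holds if \<open>tight j > 0\<close>, and also if \<open>constr_grad j\<close> vanishes identically, as for
  a pure input constraint with zero gain.\<close>

definition tightening_regular :: bool where
  "tightening_regular \<longleftrightarrow> (\<forall>j. tight j = 0 \<longrightarrow>
     (\<forall>(x, u)\<in>Z_set. constr S j x u = 0 \<longrightarrow>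
        (\<forall>\<^sub>F p in nhds (x, u). constr_grad j (fst p) (snd p) = 0)))"

subsection \<open>Cost and terminal ingredients\<close>

definition stage_cost :: "'nx rvec \<Rightarrow> 'nu rvec \<Rightarrow> real \<Rightarrow> real" where
  "stage_cost xb ub \<delta> = (wnorm (Q_mat S) xb)\<^sup>2 + (wnorm (R_mat S) ub)\<^sup>2 + lam S * \<delta>\<^sup>2"

definition cost_weights :: bool where
  "cost_weights \<longleftrightarrow> posdef (Q_mat S) \<and> posdef (R_mat S) \<and> lam S > 0"

definition tube_next :: "'nx rvec \<Rightarrow> 'nu rvec \<Rightarrow> real \<Rightarrow> real" where
  "tube_next xb ub \<delta> =
     sqrt (1 - rho_c S) * \<delta> + sqrt (alpha2 S) * (c_x S * norm (Phi_hat xb) + c_u S * norm ub)"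

definition terminal_condition :: bool where
  "terminal_condition \<longleftrightarrow>
     term_set S \<subseteq> UNIV \<times> {0..} \<and> (\<forall>xb. \<forall>\<delta>\<ge>0. l_f S xb \<delta> \<ge> 0) \<and>
     (\<forall>(xb, \<delta>)\<in>term_set S.
        let xp = F_hat xb (k_f S xb); \<delta>p = tube_next xb (k_f S xb) \<delta> in
        (xp, \<delta>p) \<in> term_set S \<and>
        (\<forall>j. constr S j xb (k_f S xb) + tight j * \<delta> \<le> 0 \<and>
             constr S j xp (k_f S xp) + tight j * \<delta>p \<le> 0) \<and>
        stage_cost xb (k_f S xb) \<delta> \<le> l_f S xb \<delta> - l_f S xp \<delta>p \<and>
        (\<forall>\<delta>h\<in>{0..\<delta>}. (xb, \<delta>h) \<in> term_set S \<and> l_f S xb \<delta>h \<le> l_f S xb \<delta>))"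

subsection \<open>Tube MPC problem\<close>

definition recursions :: "('nx, 'nu) plan \<Rightarrow> bool" where
  "recursions p \<longleftrightarrow> (\<forall>i<horizon S.
     xbar p (Suc i) = F_hat (xbar p i) (ubar p i) \<and>
     tube p (Suc i) = tube_next (xbar p i) (ubar p i) (tube p i))"

definition feasible :: "'nx rvec \<Rightarrow> ('nx, 'nu) plan \<Rightarrow> bool" where
  "feasible x p \<longleftrightarrow>
     recursions p \<and>
     (\<forall>i<horizon S. \<forall>j. constr S j (xbar p i) (ubar p i) + tight j * tube p i \<le> 0) \<and>
     V_dist x (xbar p 0) = tube p 0 \<and>
     (xbar p (horizon S), tube p (horizon S)) \<in> term_set S"

definition cost :: "('nx, 'nu) plan \<Rightarrow> real" where
  "cost p = (\<Sum>i<horizon S. stage_cost (xbar p i) (ubar p i) (tube p i))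
     + l_f S (xbar p (horizon S)) (tube p (horizon S))"

subsection \<open>Online algorithm and closed loop\<close>

definition local_plan :: "'nx rvec \<Rightarrow> ('nx, 'nu) plan" where
  "local_plan x = \<lparr>xbar = (\<lambda>_. 0), ubar = (\<lambda>_. 0), tube = (\<lambda>i. sqrt (1 - rho_c S) ^ i * V_dist x 0)\<rparr>"

text \<open>\<open>shifted x p q\<close>: \<open>q\<close> is the shift of \<open>p\<close> for the new measured state \<open>x\<close>.\<close>

definition shifted :: "'nx rvec \<Rightarrow> ('nx, 'nu) plan \<Rightarrow> ('nx, 'nu) plan \<Rightarrow> bool" where
  "shifted x p q \<longleftrightarrow>
     xbar q 0 = xbar p 1 \<and> tube q 0 = V_dist x (xbar q 0) \<and>
     (\<forall>i<horizon S. ubar q i =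
        (if Suc i < horizon S then ubar p (Suc i) else k_f S (xbar p (horizon S)))) \<and>
     recursions q"

text \<open>\<open>alg_step x q p\<close>: started from the candidate \<open>q\<close> at state \<open>x\<close>, the algorithm may return \<open>p\<close>.
  The plan \<open>r\<close> is the candidate after the (arbitrary) numerical solver.\<close>

definition alg_step :: "'nx rvec \<Rightarrow> ('nx, 'nu) plan \<Rightarrow> ('nx, 'nu) plan \<Rightarrow> bool" where
  "alg_step x q p \<longleftrightarrow> (\<exists>r. (r = q \<or> feasible x r \<and> cost r < cost q) \<and>
     p = (if feasible x (local_plan x) \<and> cost (local_plan x) < cost r then local_plan x else r))"

definition ALG :: "(nat \<Rightarrow> 'nx rvec) \<Rightarrow> (nat \<Rightarrow> ('nx, 'nu) plan) \<Rightarrow> bool" where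
  "ALG x p \<longleftrightarrow>
     (\<exists>q. feasible (x 0) q \<and> alg_step (x 0) q (p 0)) \<and>
     (\<forall>k. \<exists>q. shifted (x (Suc k)) (p k) q \<and> alg_step (x (Suc k)) q (p (Suc k)))"

definition closed_loop ::
  "(nat \<Rightarrow> 'nx rvec) \<Rightarrow> (nat \<Rightarrow> 'nu rvec) \<Rightarrow> (nat \<Rightarrow> ('nx, 'nu) plan) \<Rightarrow> bool" where
  "closed_loop x u p \<longleftrightarrow>
     (\<forall>k. u k = kappa (x k) (xbar (p k) 0) (ubar (p k) 0) \<and> x (Suc k) = F_true (x k) (u k))"

end

end

theory Submission
  imports Defs
begin

text \<open>The geodesic from the nominal to the true state, lifted to inputs by the gain, stays in
  \<open>Z_set\<close>: a constraint changes along it by at most \<open>tight j\<close> times the length travelled, and the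
  tightened constraint of the tube problem leaves room for its total length. By the proportional
  error bound the true successor state is the value of the uncertain predictor for some disturbance
  \<open>w\<close>; applying the predictor with this \<open>w\<close> to the whole lifted geodesic contracts its length by
  \<open>sqrt (1 - rho_c)\<close>, and a straight segment of length at most
  \<open>sqrt alpha2 * (c_x * norm (Phi_hat xb) + c_u * norm ub)\<close> joins the nominal successor to the start
  of the image. Hence the distance to the next nominal state is at most the next tube size. The
  shifted plan therefore has smaller tubes than the old one, which makes it feasible, and its cost is
  smaller by at least the first stage cost, so that the stage costs tend to zero.\<close>

section \<open>Cholesky factors\<close>

lemma posdef_inner_pos: "posdef P \<Longrightarrow> v \<noteq> 0 \<Longrightarrow> 0 < v \<bullet> (P *v v)"
  by (simp add: posdef_def)

lemma posdef_inner_nonneg: "posdef P \<Longrightarrow> 0 \<le> v \<bullet> (P *v v)"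
  by (cases "v = 0") (auto simp: posdef_def less_imp_le)

text \<open>A principal block of a positive definite matrix is invertible. To stay in one matrix
  type, the block on \<open>A\<close> is padded with the identity outside \<open>A\<close>; a kernel
  vector of the padded matrix is supported on \<open>A\<close> and has zero quadratic form under
  \<open>P\<close>.\<close>

lemma posdef_principal_solve:
  fixes P :: "real^'n^'n"
  assumes P: "posdef P"
  obtains c where "\<And>i. i \<notin> A \<Longrightarrow> c $ i = 0" "\<And>i. i \<in> A \<Longrightarrow> (P *v c) $ i = d $ i"
proof -
  define P' :: "real^'n^'n" where
    "P' = (\<chi> i j. if i \<in> A \<and> j \<in> A then P $ i $ j else if i = j then 1 else 0)"
  have out: "(P' *v v) $ i = v $ i" if "i \<notin> A" for v i
  proof -
    have "(P' *v v) $ i = (\<Sum>j\<in>UNIV. (if j = i then v $ j else 0))"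
      unfolding matrix_vector_mult_def vec_lambda_beta P'_def
      by (rule sum.cong) (use that in auto)
    then show ?thesis by simp
  qed
  have ins: "(P' *v v) $ i = (P *v v) $ i" if "i \<in> A" and v: "\<And>j. j \<notin> A \<Longrightarrow> v $ j = 0" for v i
    unfolding matrix_vector_mult_def vec_lambda_beta P'_def
    by (rule sum.cong) (use that in auto)
  have ker: "v = 0" if "P' *v v = 0" for v
  proof (rule ccontr)
    assume "v \<noteq> 0"
    have v: "v $ j = 0" if "j \<notin> A" for j
      using out[OF that, of v] \<open>P' *v v = 0\<close> by simp
    have "v \<bullet> (P *v v) = 0"
      unfolding inner_vec_def
    proof (rule sum.neutral, rule ballI)
      fix i show "v $ i \<bullet> (P *v v) $ i = 0"
      proof (cases "i \<in> A")
        case True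
        then show ?thesis using ins[OF True v] \<open>P' *v v = 0\<close> by simp
      qed (use v in simp)
    qed
    then show False using posdef_inner_pos[OF P \<open>v \<noteq> 0\<close>] by simp
  qed
  then have "\<exists>B. B ** P' = mat 1" unfolding matrix_left_invertible_ker by blast
  then obtain B where "P' ** B = mat 1" using matrix_left_right_inverse by blast
  define e :: "real^'n" where "e = (\<chi> i. if i \<in> A then d $ i else 0)"
  define c where "c = B *v e"
  have c: "P' *v c = e" by (simp add: c_def matrix_vector_mul_assoc \<open>P' ** B = mat 1\<close>)
  have z: "c $ i = 0" if "i \<notin> A" for i using out[OF that, of c] that by (simp add: c e_def)
  show ?thesis
  proof (rule that[OF z])
    show "(P *v c) $ i = d $ i" if "i \<in> A" for i
      using ins[OF that z] that by (simp add: c e_def)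
  qed
qed

text \<open>The columns \<open>r i\<close> of the factor are built in increasing order; the new column is the
  \<open>P\<close>-orthogonal projection of the new basis vector onto the previous ones plus a multiple of
  that basis vector.\<close>

lemma cholesky_columns:
  fixes P :: "('n::{finite,linorder}, 'n) rmat"
  assumes P: "posdef P"
  shows "\<exists>r :: 'n \<Rightarrow> 'n rvec. (\<forall>i\<in>A. \<forall>k. (i < k \<or> k \<notin> A) \<longrightarrow> r i $ k = 0) \<and>
     (\<forall>i\<in>A. r i $ i > 0) \<and> (\<forall>i\<in>A. \<forall>j\<in>A. r i \<bullet> r j = P $ i $ j)"
  (is "\<exists>r. ?Q A r")
using finite[of A]
proof (induction A rule: finite_linorder_max_induct)
  case empty
  show ?case by simp
next
  case (insert b A)
  then obtain r where r: "?Q A r" by blast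
  have "b \<notin> A" using insert by auto
  have sym: "P $ i $ j = P $ j $ i" for i j
  proof -
    have "transpose P $ j $ i = P $ j $ i" using P by (simp add: posdef_def)
    then show ?thesis by (simp add: transpose_def)
  qed
  \<comment> \<open>\<open>c\<close> is the \<open>P\<close>-orthogonal projection of
    \<open>axis b 1\<close> onto the span of the basis vectors in \<open>A\<close>; the residual
    \<open>q\<close> then has positive squared length \<open>t\<^sup>2\<close>, the Schur
    complement.\<close>
  obtain c where c0: "\<And>i. i \<notin> A \<Longrightarrow> c $ i = 0"
    and cA: "\<And>i. i \<in> A \<Longrightarrow> (P *v c) $ i = (P *v axis b 1) $ i"
    using posdef_principal_solve[OF P, of A "P *v axis b 1"] by blast
  define q where "q = axis b 1 - c"
  define t where "t = sqrt (q \<bullet> (P *v q))"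
  have "q $ b \<noteq> 0" using c0[OF \<open>b \<notin> A\<close>] by (simp add: q_def)
  then have "q \<noteq> 0" by auto
  then have "t > 0" using posdef_inner_pos[OF P] by (simp add: t_def)
  have PqA: "(P *v q) $ i = 0" if "i \<in> A" for i
    using cA[OF that] by (simp add: q_def matrix_vector_mult_diff_distrib)
  have cPq: "c \<bullet> (P *v q) = 0"
    unfolding inner_vec_def by (rule sum.neutral) (use PqA c0 in fastforce)
  define s where "s = (\<Sum>i\<in>A. c $ i *\<^sub>R r i)"
  \<comment> \<open>Earlier columns and \<open>s\<close> itself vanish at coordinate
    \<open>b\<close>, so the added multiple of \<open>axis b 1\<close> changes no inner product with
    an earlier column and contributes exactly \<open>t\<^sup>2\<close> to the squared
    length.\<close>
  define rb where "rb = s + t *\<^sub>R axis b 1"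
  have sumA: "(\<Sum>i\<in>A. c $ i * f i) = (\<Sum>i\<in>UNIV. c $ i * f i)" for f
    by (rule sum.mono_neutral_left) (use c0 in auto)
  have Pax: "(P *v axis b 1) $ i = P $ i $ b" for i
    by (simp add: matrix_vector_mul_component inner_axis)
  have rj: "s \<bullet> r j = P $ b $ j" if "j \<in> A" for j
  proof -
    have "s \<bullet> r j = (\<Sum>i\<in>A. c $ i * P $ i $ j)"
      using r that by (simp add: s_def inner_sum_left)
    also have "\<dots> = (\<Sum>i\<in>UNIV. c $ i * P $ j $ i)" using sumA[of "\<lambda>i. P $ i $ j"] sym by simp
    also have "\<dots> = (P *v c) $ j" by (simp add: matrix_vector_mult_def mult.commute)
    also have "\<dots> = P $ b $ j" using cA[OF that] Pax sym by simp
    finally show ?thesis .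
  qed
  have rb0: "r i $ b = 0" if "i \<in> A" for i using r that \<open>b \<notin> A\<close> by blast
  have sb: "s $ k = 0" if "k \<notin> A" for k
    using r that by (auto simp: s_def intro!: sum.neutral)
  have ss: "s \<bullet> s = c \<bullet> (P *v axis b 1)"
  proof -
    have "s \<bullet> s = (\<Sum>i\<in>A. c $ i * (s \<bullet> r i))"
      by (subst (2) s_def) (simp add: inner_sum_right)
    also have "\<dots> = (\<Sum>i\<in>A. c $ i * P $ i $ b)" using rj sym by simp
    also have "\<dots> = c \<bullet> (P *v axis b 1)" using sumA[of "\<lambda>i. P $ i $ b"] Pax by (simp add: inner_vec_def)
    finally show ?thesis .
  qed
  have "q \<bullet> (P *v q) = axis b 1 \<bullet> (P *v q)" using cPq by (simp add: q_def inner_diff_left)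
  also have "\<dots> = P $ b $ b - (P *v c) $ b"
    using Pax[of b] by (simp add: q_def inner_axis' matrix_vector_mult_diff_distrib)
  also have "(P *v c) $ b = c \<bullet> (P *v axis b 1)"
    using sym by (simp add: matrix_vector_mult_def inner_vec_def Pax axis_def if_distrib cong: if_cong)
      (simp add: mult.commute)
  finally have tt: "t\<^sup>2 = P $ b $ b - s \<bullet> s"
    using posdef_inner_nonneg[OF P, of q] by (simp add: t_def ss)
  have bb: "rb \<bullet> rb = P $ b $ b"
    using tt sb[OF \<open>b \<notin> A\<close>]
    by (simp add: rb_def inner_add_left inner_add_right inner_axis inner_axis' power2_eq_square)
  have bj: "rb \<bullet> r j = P $ b $ j" if "j \<in> A" for j
    using rj[OF that] rb0[OF that] by (simp add: rb_def inner_add_left inner_axis')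
  have "?Q (insert b A) (r(b := rb))"
  proof (intro conjI)
    show "\<forall>i\<in>insert b A. \<forall>k. (i < k \<or> k \<notin> insert b A) \<longrightarrow> (r(b := rb)) i $ k = 0"
    proof (intro ballI allI impI)
      fix i k assume i: "i \<in> insert b A" and k: "i < k \<or> k \<notin> insert b A"
      show "(r(b := rb)) i $ k = 0"
      proof (cases "i = b")
        case True
        then have "k \<noteq> b" "k \<notin> A" using k insert by auto
        then show ?thesis using True sb by (simp add: rb_def axis_def)
      qed (use i k r in auto)
    qed
    show "\<forall>i\<in>insert b A. (r(b := rb)) i $ i > 0"
      using r \<open>t > 0\<close> sb[OF \<open>b \<notin> A\<close>] by (auto simp: rb_def)
    show "\<forall>i\<in>insert b A. \<forall>j\<in>insert b A. (r(b := rb)) i \<bullet> (r(b := rb)) j = P $ i $ j"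
      using r bb bj sym by (auto simp: inner_commute)
  qed
  then show ?case by blast
qed

lemma cholesky_exists:
  fixes P :: "('n::{finite,linorder}, 'n) rmat"
  assumes "posdef P"
  shows "\<exists>R. (\<forall>i j. j < i \<longrightarrow> R $ i $ j = 0) \<and> (\<forall>i. R $ i $ i > 0) \<and> transpose R ** R = P"
proof -
  obtain r :: "'n \<Rightarrow> 'n rvec" where "\<And>i k. i < k \<Longrightarrow> r i $ k = 0" "\<And>i. r i $ i > 0"
    "\<And>i j. r i \<bullet> r j = P $ i $ j"
    using cholesky_columns[OF assms, of UNIV] by auto
  then show ?thesis
    by (intro exI[of _ "\<chi> k i. r i $ k"])
      (simp add: vec_eq_iff matrix_matrix_mult_def transpose_def inner_vec_def)
qed

text \<open>Rows are determined in increasing order. Once the rows above row \<open>k\<close> agree,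
  entry \<open>(k, k)\<close> of the product fixes the square of the diagonal entry, positivity
  fixes its sign, and entry \<open>(k, j)\<close> then fixes the rest of the row.\<close>

lemma cholesky_unique:
  fixes R T :: "('n::{finite,linorder}, 'n) rmat"
  assumes R: "\<And>i j. j < i \<Longrightarrow> R $ i $ j = 0" "\<And>i. R $ i $ i > 0"
    and T: "\<And>i j. j < i \<Longrightarrow> T $ i $ j = 0" "\<And>i. T $ i $ i > 0"
    and eq: "transpose R ** R = transpose T ** T"
  shows "R = T"
proof -
  have expand: "(transpose X ** X) $ k $ j = (\<Sum>l\<in>{..<k}. X $ l $ k * X $ l $ j) + X $ k $ k * X $ k $ j"
    if "\<And>i j. j < i \<Longrightarrow> X $ i $ j = 0" for X :: "('n, 'n) rmat" and k j
  proof -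
    have "(transpose X ** X) $ k $ j = (\<Sum>l\<in>UNIV. X $ l $ k * X $ l $ j)"
      by (simp add: matrix_matrix_mult_def transpose_def)
    also have "\<dots> = (\<Sum>l\<in>insert k {..<k}. X $ l $ k * X $ l $ j)"
      by (rule sum.mono_neutral_right) (use that in \<open>auto simp: not_less order_le_less\<close>)
    finally show ?thesis by (simp add: add.commute)
  qed
  have "R $ k $ j = T $ k $ j" for k j
  \<comment> \<open>The index type is only a finite linear order, so the induction counts the
    smaller indices.\<close>
  proof (induction "card {..<k}" arbitrary: k j rule: less_induct)
    case less
    have IH: "R $ l $ m = T $ l $ m" if "l < k" for l m
      by (rule less, rule psubset_card_mono) (use that in auto)
    have e: "R $ k $ k * R $ k $ m = T $ k $ k * T $ k $ m" for m
      using expand[of R k m, OF R(1)] expand[of T k m, OF T(1)] eq IH by simp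
    have "R $ k $ k = T $ k $ k"
      using e[of k] R(2)[of k] T(2)[of k] by (metis abs_of_pos abs_eq_iff square_eq_iff)
    then show ?case using e[of j] R(2)[of k] by simp
  qed
  then show ?thesis by (simp add: vec_eq_iff)
qed

text \<open>Existence and uniqueness together let the definite description in
  \<open>cholesky\<close> denote.\<close>

lemma cholesky_factor:
  fixes P :: "('n::{finite,linorder}, 'n) rmat"
  assumes "posdef P"
  shows "transpose (cholesky P) ** cholesky P = P"
proof -
  have "\<exists>!R. (\<forall>i j. j < i \<longrightarrow> R $ i $ j = 0) \<and> (\<forall>i. R $ i $ i > 0) \<and> transpose R ** R = P"
    using cholesky_exists[OF assms] cholesky_unique by (metis (no_types, lifting))
  from theI'[OF this] show ?thesis by (simp add: cholesky_def)
qed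

lemma norm_cholesky:
  fixes P :: "('n::{finite,linorder}, 'n) rmat"
  assumes "posdef P"
  shows "norm (cholesky P *v v) = wnorm P v"
proof -
  have "(cholesky P *v v) \<bullet> (cholesky P *v v) = v \<bullet> (transpose (cholesky P) *v (cholesky P *v v))"
    by (metis dot_lmul_matrix inner_commute transpose_matrix_vector)
  also have "\<dots> = v \<bullet> (P *v v)"
    by (simp add: matrix_vector_mul_assoc cholesky_factor[OF assms])
  finally show ?thesis by (simp add: wnorm_def norm_eq_sqrt_inner)
qed

lemma cholesky_inverse:
  fixes P :: "('n::{finite,linorder}, 'n) rmat"
  assumes "posdef P"
  shows "cholesky P ** matrix_inv (cholesky P) = mat 1" "matrix_inv (cholesky P) ** cholesky P = mat 1"
proof -
  have "v = 0" if "cholesky P *v v = 0" for v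
    using norm_cholesky[OF assms, of v] posdef_inner_pos[OF assms, of v] that by (auto simp: wnorm_def)
  then have "\<exists>B. B ** cholesky P = mat 1" unfolding matrix_left_invertible_ker by blast
  then have "invertible (cholesky P)" by (simp add: invertible_left_inverse)
  then show "cholesky P ** matrix_inv (cholesky P) = mat 1" "matrix_inv (cholesky P) ** cholesky P = mat 1"
    using someI_ex[of "\<lambda>A'. cholesky P ** A' = mat 1 \<and> A' ** cholesky P = mat 1"]
    unfolding invertible_def matrix_inv_def by blast+
qed

text \<open>Cauchy-Schwarz after inserting the factor and its inverse. For a constraint gradient
  \<open>g\<close>, the first norm is the quantity whose supremum is \<open>tight\<close>; for a
  velocity \<open>v\<close>, the second is the Riemannian speed.\<close>

lemma inner_le_cholesky:
  fixes P :: "('n::{finite,linorder}, 'n) rmat"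
  assumes "posdef P"
  shows "g \<bullet> v \<le> norm (g v* matrix_inv (cholesky P)) * wnorm P v"
proof -
  have "g \<bullet> v = g \<bullet> (matrix_inv (cholesky P) *v (cholesky P *v v))"
    by (simp add: matrix_vector_mul_assoc cholesky_inverse[OF assms])
  also have "\<dots> = (g v* matrix_inv (cholesky P)) \<bullet> (cholesky P *v v)"
    by (simp add: dot_lmul_matrix)
  also have "\<dots> \<le> norm (g v* matrix_inv (cholesky P)) * wnorm P v"
    using norm_cauchy_schwarz norm_cholesky[OF assms] by metis
  finally show ?thesis .
qed

text \<open>Serves to show that the supremum defining \<open>tight\<close> is taken over a bounded
  set.\<close>

lemma norm_cholesky_inverse_le:
  fixes P :: "('n::{finite,linorder}, 'n) rmat"
  assumes P: "posdef P" and a: "a > 0" "loewner_le (a *\<^sub>R mat 1) P"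
  shows "norm (g v* matrix_inv (cholesky P)) \<le> norm g / sqrt a"
proof -
  define y where "y = g v* matrix_inv (cholesky P)"
  \<comment> \<open>\<open>z\<close> is the inverse of \<open>P\<close> applied to \<open>g\<close>,
    so \<open>y\<close> and \<open>z\<close> satisfy both \<open>norm y = wnorm P z\<close> and
    \<open>y \<bullet> y = g \<bullet> z\<close>.\<close>
  define z where "z = matrix_inv (cholesky P) *v y"
  have "cholesky P *v z = y"
    by (simp add: z_def matrix_vector_mul_assoc cholesky_inverse[OF P])
  then have "norm y = wnorm P z" using norm_cholesky[OF P] by metis
  moreover have "sqrt (a * (z \<bullet> z)) \<le> wnorm P z"
    using a(2) by (auto simp: loewner_le_def wnorm_def scaleR_matrix_vector_assoc[symmetric])
  ultimately have z: "sqrt a * norm z \<le> norm y"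
    by (simp add: real_sqrt_mult norm_eq_sqrt_inner)
  have "norm y * norm y = y \<bullet> y" by (simp add: dot_square_norm power2_eq_square)
  also have "\<dots> = g \<bullet> z" unfolding z_def by (subst y_def) (rule dot_lmul_matrix)
  also have "\<dots> \<le> norm g * norm z" by (rule norm_cauchy_schwarz)
  also have "\<dots> \<le> norm g * (norm y / sqrt a)"
    using z a(1) by (intro mult_left_mono) (auto simp: field_simps)
  finally have "norm y * norm y \<le> (norm g / sqrt a) * norm y" by simp
  then have "norm y \<le> norm g / sqrt a"
    using a(1) mult_right_le_imp_le[of "norm y" "norm y" "norm g / sqrt a"] by (cases "y = 0") auto
  then show ?thesis by (simp add: y_def)
qed

section \<open>Calculus\<close>

lemma has_derivative_vec:
  fixes f :: "'a::real_normed_vector \<Rightarrow> real^'n"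
  assumes "\<And>i. ((\<lambda>x. f x $ i) has_derivative (\<lambda>h. f' h $ i)) (at x within T)"
  shows "(f has_derivative f') (at x within T)"
  using assms
  by (subst has_derivative_componentwise_within) (auto simp: Basis_vec_def inner_axis)

lemma C1_continuous: "C1 f \<Longrightarrow> continuous_on T f"
  unfolding C1_def
  by (meson continuous_on_subset differentiableI differentiable_imp_continuous_on differentiable_on_def
      differentiable_at_withinI subset_UNIV)

lemma continuous_on_matrix_vector:
  fixes P :: "'a::topological_space \<Rightarrow> real^'n^'m"
  assumes "continuous_on T P" "continuous_on T v"
  shows "continuous_on T (\<lambda>s. P s *v v s)"
  unfolding matrix_vector_mult_def by (intro continuous_intros assms)

section \<open>Norms weighted by a positive definite matrix\<close>

lemma continuous_on_wnorm:
  assumes "continuous_on T P" "continuous_on T v"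
  shows "continuous_on T (\<lambda>s. wnorm (P s) (v s))"
  unfolding wnorm_def by (intro continuous_intros continuous_on_matrix_vector assms)

lemma wnorm_nonneg: "posdef P \<Longrightarrow> 0 \<le> wnorm P v"
  by (simp add: wnorm_def posdef_inner_nonneg)

lemma wnorm_eq_0: "posdef P \<Longrightarrow> wnorm P v = 0 \<longleftrightarrow> v = 0"
  using posdef_inner_pos[of P v] by (cases "v = 0") (auto simp: wnorm_def)

lemma wnorm_scaleR: "wnorm P (c *\<^sub>R v) = \<bar>c\<bar> * wnorm P v"
  by (simp add: wnorm_def matrix_vector_mult_scaleR real_sqrt_mult mult.assoc[symmetric])

lemma wnorm_le_of_loewner_le:
  assumes "loewner_le P (a *\<^sub>R mat 1)" "0 \<le> a"
  shows "wnorm P v \<le> sqrt a * norm v"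
proof -
  have "v \<bullet> (P *v v) \<le> a * (v \<bullet> v)"
    using assms by (simp add: loewner_le_def scaleR_matrix_vector_assoc[symmetric])
  then have "wnorm P v \<le> sqrt (a * (v \<bullet> v))" by (simp add: wnorm_def)
  then show ?thesis by (simp add: real_sqrt_mult norm_eq_sqrt_inner)
qed

text \<open>Turns the matrix inequality of \<open>RCCM\<close> into a contraction of tangent
  vectors.\<close>

lemma wnorm_contraction:
  assumes "loewner_le (transpose A ** P ** A) (c *\<^sub>R R)"
  shows "wnorm P (A *v v) \<le> sqrt c * wnorm R v"
proof -
  have "v \<bullet> ((transpose A ** P ** A) *v v) = (A *v v) \<bullet> (P *v (A *v v))"
    by (metis dot_lmul_matrix inner_commute matrix_vector_mul_assoc transpose_matrix_vector)
  moreover have "v \<bullet> ((transpose A ** P ** A) *v v) \<le> c * (v \<bullet> (R *v v))"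
    using assms by (simp add: loewner_le_def scaleR_matrix_vector_assoc[symmetric])
  ultimately have "(A *v v) \<bullet> (P *v (A *v v)) \<le> c * (v \<bullet> (R *v v))" by simp
  then show ?thesis by (simp add: wnorm_def flip: real_sqrt_mult)
qed

section \<open>Partial derivatives, Jacobians and gradients\<close>

lemma has_derivative_sections:
  assumes "((\<lambda>p. f (fst p) (snd p)) has_derivative D) (at (x, u))"
  shows "((\<lambda>y. f y u) has_derivative (\<lambda>h. D (h, 0))) (at x)"
    and "((\<lambda>v. f x v) has_derivative (\<lambda>h. D (0, h))) (at u)"
proof -
  have "((\<lambda>y. (y, u)) has_derivative (\<lambda>h. (h, 0))) (at x)"
    by (auto intro!: derivative_eq_intros)
  from has_derivative_compose[OF this assms] show "((\<lambda>y. f y u) has_derivative (\<lambda>h. D (h, 0))) (at x)"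
    by simp
  have "((\<lambda>v. (x, v)) has_derivative (\<lambda>h. (0, h))) (at u)"
    by (auto intro!: derivative_eq_intros)
  from has_derivative_compose[OF this assms] show "((\<lambda>v. f x v) has_derivative (\<lambda>h. D (0, h))) (at u)"
    by simp
qed

lemma has_derivative_pair_split:
  assumes "(f has_derivative D) F"
  shows "D (h, k) = D (h, 0) + D (0, k)"
  using linear_add[OF has_derivative_linear[OF assms], of "(h, 0)" "(0, k)"] by simp

lemma jacobian_apply:
  fixes f :: "real^'n \<Rightarrow> real^'m"
  assumes "(f has_derivative D) (at x)"
  shows "jacobian f (at x) *v v = D v"
proof -
  have "f differentiable at x" using assms by (rule differentiableI)
  then have "(f has_derivative (\<lambda>h. jacobian f (at x) *v h)) (at x)" by (simp only: jacobian_works)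
  then show ?thesis using has_derivative_unique[OF assms] by metis
qed

lemma grad_inner:
  assumes "(\<psi> has_derivative D) (at x)"
  shows "grad \<psi> x \<bullet> v = D v"
proof -
  have lin: "linear D" using assms by (rule has_derivative_linear)
  have "D v = D (\<Sum>i\<in>UNIV. v $ i *\<^sub>R axis i 1)"
    using basis_expansion[of v] by (simp add: scalar_mult_eq_scaleR)
  also have "\<dots> = (\<Sum>i\<in>UNIV. v $ i * D (axis i 1))"
    using lin by (simp add: linear_sum linear_cmul)
  also have "\<dots> = grad \<psi> x \<bullet> v"
    using frechet_derivative_at[OF assms] by (simp add: grad_def inner_vec_def mult.commute)
  finally show ?thesis by simp
qed

section \<open>Curves\<close>

lemma curves_endpoints: "\<gamma> \<in> curves a b \<Longrightarrow> \<gamma> 0 = a" "\<gamma> \<in> curves a b \<Longrightarrow> \<gamma> 1 = b"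
  by (auto simp: curves_def)

lemma cdot_eq:
  "(\<gamma> has_vector_derivative v) (at s within {0..1}) \<Longrightarrow> s \<in> {0..1} \<Longrightarrow> cdot \<gamma> s = v"
  unfolding cdot_def by (intro vector_derivative_within_closed_interval) auto

lemma curves_has_cdot:
  assumes "\<gamma> \<in> curves a b" "s \<in> {0..1}"
  shows "(\<gamma> has_vector_derivative cdot \<gamma> s) (at s within {0..1})"
  using assms cdot_eq unfolding curves_def by fastforce

lemma continuous_on_cdot:
  assumes "\<gamma> \<in> curves a b"
  shows "continuous_on {0..1} (cdot \<gamma>)"
proof -
  obtain D where D: "\<And>s. s \<in> {0..1} \<Longrightarrow> (\<gamma> has_vector_derivative D s) (at s within {0..1})"
    "continuous_on {0..1} D" using assms unfolding curves_def by blast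
  then show ?thesis by (metis (no_types, lifting) cdot_eq continuous_on_cong)
qed

lemma continuous_on_curve: "\<gamma> \<in> curves a b \<Longrightarrow> continuous_on {0..1} \<gamma>"
  using curves_has_cdot continuous_on_vector_derivative by blast

lemma curvesI:
  assumes "\<gamma> 0 = a" "\<gamma> 1 = b"
    "\<And>s. s \<in> {0..1} \<Longrightarrow> (\<gamma> has_vector_derivative D s) (at s within {0..1})" "continuous_on {0..1} D"
  shows "\<gamma> \<in> curves a b"
  using assms unfolding curves_def by blast

text \<open>Squaring removes the kink of the ramp at 0. The resulting continuously differentiable
  function reparametrises two curves in \<open>curves_join\<close> so that both have velocity zero
  where they meet.\<close>

lemma has_real_derivative_ramp_square:
  "((\<lambda>t::real. (max 0 t)\<^sup>2) has_real_derivative 2 * max 0 t) (at t)"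
proof -
  consider "t > 0" | "t < 0" | "t = 0" by linarith
  then show ?thesis
  proof cases
    case 1
    have "((\<lambda>t::real. t\<^sup>2) has_real_derivative 2 * max 0 t) (at t)"
      using 1 by (auto intro!: derivative_eq_intros)
    then show ?thesis
      by (rule has_field_derivative_transform_within_open[where S = "{0<..}"]) (use 1 in auto)
  next
    case 2
    have "((\<lambda>t::real. 0) has_real_derivative 2 * max 0 t) (at t)"
      using 2 by (auto intro!: derivative_eq_intros)
    then show ?thesis
      by (rule has_field_derivative_transform_within_open[where S = "{..<0}"]) (use 2 in auto)
  next
    case 3
    have "((\<lambda>h::real. (max 0 h)\<^sup>2 / h) \<longlongrightarrow> 0) (at 0)"
    proof (rule Lim_null_comparison)
      show "\<forall>\<^sub>F h::real in at 0. norm ((max 0 h)\<^sup>2 / h) \<le> \<bar>h\<bar>"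
        by (auto simp: eventually_at_filter max_def power2_eq_square)
      show "((\<lambda>h::real. \<bar>h\<bar>) \<longlongrightarrow> 0) (at 0)" by (auto intro!: tendsto_eq_intros)
    qed
    then show ?thesis using 3 by (simp add: has_field_derivative_iff)
  qed
qed

text \<open>A first-exit argument, needed because \<open>bound\<close> holds only where all
  constraints hold already. At the infimum \<open>a\<close> of the violation times every constraint
  still holds. One with \<open>H i a = 0\<close> and \<open>c i > 0\<close> has spent the whole
  budget granted by \<open>init\<close>, so no length is left and \<open>still\<close> freezes it;
  if \<open>c i = 0\<close>, then \<open>flat\<close> freezes it for a while. Hence nothing is
  violated shortly after \<open>a\<close>, a contradiction.\<close>

lemma barrier_continuation:
  fixes H :: "'c::finite \<Rightarrow> real \<Rightarrow> real" and w :: "real \<Rightarrow> real"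
  assumes w: "continuous_on {0..1} w" "\<And>t. t \<in> {0..1} \<Longrightarrow> 0 \<le> w t"
    and c: "\<And>j. 0 \<le> c j"
    and deriv: "\<And>j t. t \<in> {0..1} \<Longrightarrow> (H j has_vector_derivative G j t) (at t within {0..1})"
    and bound: "\<And>j t. t \<in> {0..1} \<Longrightarrow> \<forall>i. H i t \<le> 0 \<Longrightarrow> G j t \<le> c j * w t"
    and still: "\<And>j t. t \<in> {0..1} \<Longrightarrow> w t = 0 \<Longrightarrow> G j t = 0"
    and flat: "\<And>j t. t \<in> {0..1} \<Longrightarrow> \<forall>i. H i t \<le> 0 \<Longrightarrow> H j t = 0 \<Longrightarrow> c j = 0 \<Longrightarrow>
       \<exists>d>0. \<forall>r\<in>{0..1}. \<bar>r - t\<bar> < d \<longrightarrow> G j r = 0"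
    and init: "\<And>j. H j 0 + c j * integral {0..1} w \<le> 0"
    and t: "t \<in> {0..1}"
  shows "H j t \<le> 0"
proof (rule ccontr)
  assume "\<not> H j t \<le> 0"
  define B where "B = {t\<in>{0..1}. \<exists>j. H j t > 0}"
  have "t \<in> B" using \<open>\<not> H j t \<le> 0\<close> t unfolding B_def by (auto simp: not_le)
  have bdd: "bdd_below B" by (auto simp: B_def intro!: bdd_belowI[of _ 0])
  define a where "a = Inf B"
  have "a \<le> t" unfolding a_def using \<open>t \<in> B\<close> bdd by (rule cInf_lower)
  have "a \<ge> 0" unfolding a_def using \<open>t \<in> B\<close> by (intro cInf_greatest) (auto simp: B_def)
  have a: "a \<in> {0..1}" using \<open>a \<le> t\<close> \<open>0 \<le> a\<close> t by auto
  have before: "H i r \<le> 0" if "0 \<le> r" "r < a" for i r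
  proof (rule ccontr)
    assume "\<not> H i r \<le> 0"
    then have "r \<in> B" using that a by (auto simp: B_def not_le)
    then have "a \<le> r" unfolding a_def using bdd by (rule cInf_lower)
    then show False using that by simp
  qed
  have cont: "continuous_on {0..1} (H i)" for i
    using deriv continuous_on_vector_derivative by blast
  have Iw: "integral {0..1} w \<ge> 0" by (intro integral_nonneg integrable_continuous_real w)
  \<comment> \<open>At \<open>a = 0\<close> this is the initial slack; otherwise it is a left limit
    of nonpositive values.\<close>
  have at_a: "H i a \<le> 0" for i
  proof (cases "a = 0")
    case True
    then show ?thesis using init[of i] c[of i] Iw by (smt (verit) mult_nonneg_nonneg)
  next
    case False
    have "(H i \<longlongrightarrow> H i a) (at_left a)"
      using cont[of i] a False
      by (metis atLeastAtMost_iff continuous_on_Icc_at_leftD continuous_on_subset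
          atLeastatMost_subset_iff order_refl order_le_less)
    moreover have "\<forall>\<^sub>F r in at_left a. H i r \<le> 0"
      using eventually_at_left_real[of 0 a] False \<open>0 \<le> a\<close> by (auto elim!: eventually_mono intro: before)
    ultimately show ?thesis by (intro tendsto_upperbound[of "H i" _ "at_left a"]) auto
  qed
  have upto: "\<forall>i. H i r \<le> 0" if "r \<in> {0..a}" for r
    using that before at_a by (cases "r = a") auto
  have int_w: "w integrable_on {p..q}" if "0 \<le> p" "q \<le> 1" for p q
    by (rule integrable_continuous_real) (use w(1) that continuous_on_subset in fastforce)
  have ftc: "(G i has_integral (H i q - H i p)) {p..q}" if "0 \<le> p" "p \<le> q" "q \<le> 1" for i p q
    by (rule fundamental_theorem_of_calculus)
      (use that in \<open>auto intro: has_vector_derivative_within_subset[OF deriv]\<close>)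
  have ahead: "\<exists>d>0. \<forall>r\<in>{a..1}. \<bar>r - a\<bar> < d \<longrightarrow> H i r \<le> 0" for i
  proof -
    consider "a = 1" | "H i a < 0" | "a < 1" "H i a = 0" using a at_a[of i] by fastforce
    then show ?thesis
    proof cases
      case 1
      then show ?thesis using at_a[of i] by (intro exI[of _ 1]) auto
    next
      case 2
      obtain d where "d > 0" and d_H: "\<And>r. r \<in> {0..1} \<Longrightarrow> dist r a < d \<Longrightarrow> dist (H i r) (H i a) < - H i a"
        using cont[of i] a 2 unfolding continuous_on_iff by (metis neg_0_less_iff_less)
      then have "H i r \<le> 0" if "r \<in> {a..1}" "\<bar>r - a\<bar> < d" for r
      proof -
        have "r \<in> {0..1}" using that a by auto
        then have "dist (H i r) (H i a) < - H i a" using that d_H by (simp add: dist_real_def)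
        then show ?thesis unfolding dist_real_def by linarith
      qed
      then show ?thesis using \<open>d > 0\<close> by blast
    next
      case 3
      note Ha = \<open>H i a = 0\<close>
      have "\<exists>d>0. \<forall>r\<in>{a..1}. \<bar>r - a\<bar> < d \<longrightarrow> G i r = 0"
      proof (cases "c i = 0")
        case True
        then show ?thesis using flat[OF a _ Ha True] at_a a by fastforce
      next
        case False
        then have "c i > 0" using c[of i] by simp
        \<comment> \<open>With \<open>H i a = 0\<close>, the growth up to \<open>a\<close> must make
          up for an initial slack of at least \<open>c i\<close> times the full integral, which
          leaves nothing for the integral over \<open>{a..1}\<close>.\<close>
        have "H i a - H i 0 \<le> c i * integral {0..a} w"
        proof (rule has_integral_le[OF ftc])
          show "((\<lambda>t. c i * w t) has_integral c i * integral {0..a} w) {0..a}"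
            using int_w[of 0 a] a by (intro has_integral_mult_right integrable_integral) auto
          show "G i r \<le> c i * w r" if "r \<in> {0..a}" for r
            using that a upto[OF that] by (intro bound) auto
        qed (use a in auto)
        moreover have "integral {0..a} w + integral {a..1} w = integral {0..1} w"
          using a int_w by (intro Henstock_Kurzweil_Integration.integral_combine) auto
        ultimately have "c i * integral {a..1} w \<le> 0"
          using init[of i] Ha by (smt (verit) distrib_left)
        then have "integral {a..1} w \<le> 0" using \<open>c i > 0\<close> by (simp add: mult_le_0_iff)
        moreover have "integral {a..1} w \<ge> 0"
          using a int_w w by (intro integral_nonneg) auto
        ultimately have I: "integral {a..1} w = 0" by simp
        \<comment> \<open>A continuous nonnegative function with zero integral vanishes.\<close>
        have "w r = 0" if "r \<in> {a..1}" for r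
          using integral_eq_0_iff[of a 1 w] I that w a \<open>a < 1\<close>
          by (metis atLeastatMost_subset_iff atLeastAtMost_iff continuous_on_subset order_trans order_refl)
        then show ?thesis using still a by (intro exI[of _ 1]) auto
      qed
      then obtain d where d: "d > 0" "\<And>r. r \<in> {a..1} \<Longrightarrow> \<bar>r - a\<bar> < d \<Longrightarrow> G i r = 0" by blast
      have "H i r \<le> 0" if "r \<in> {a..1}" "\<bar>r - a\<bar> < d" for r
      proof -
        have "(G i has_integral 0) {a..r}"
          using that d by (intro has_integral_is_0) auto
        moreover have "(G i has_integral (H i r - H i a)) {a..r}"
          by (rule ftc) (use that a in auto)
        ultimately have "H i r - H i a = 0" by (metis has_integral_unique)
        then show ?thesis using Ha by simp
      qed
      then show ?thesis using d by blast
    qed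
  qed
  then obtain d where d: "\<And>i. d i > 0" "\<And>i r. r \<in> {a..1} \<Longrightarrow> \<bar>r - a\<bar> < d i \<Longrightarrow> H i r \<le> 0" by metis
  \<comment> \<open>There are finitely many constraints, so the radii have a positive
    minimum.\<close>
  define e where "e = Min (range d)"
  have "e > 0" and e: "e \<le> d i" for i using d by (auto simp: e_def)
  then obtain b where "b \<in> B" "b < a + e"
    using cInf_lessD[of B "a + e"] \<open>t \<in> B\<close> unfolding a_def by auto
  moreover have "a \<le> b" unfolding a_def using \<open>b \<in> B\<close> bdd by (rule cInf_lower)
  moreover obtain i where "H i b > 0" "b \<le> 1" using \<open>b \<in> B\<close> unfolding B_def by auto
  moreover have "H i b \<le> 0"
    using \<open>b \<in> B\<close> \<open>b < a + e\<close> \<open>a \<le> b\<close> \<open>b \<le> 1\<close> e[of i] by (intro d(2)) auto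
  ultimately show False by linarith
qed

section \<open>Riemannian distance\<close>

context
  fixes S :: "('nx::{finite,linorder}, 'ne::finite, 'nu::finite, 'nc::finite, 'd::finite) mpc"
  assumes metric_posdef: "\<And>x. posdef (metric S x)"
    and metric_continuous: "\<And>T. continuous_on T (metric S)"
begin

lemma continuous_on_speed:
  assumes "\<gamma> \<in> curves a b"
  shows "continuous_on {0..1} (\<lambda>s. wnorm (metric S (\<gamma> s)) (cdot \<gamma> s))"
  by (intro continuous_on_wnorm continuous_on_compose2[OF metric_continuous[of UNIV]]
      continuous_on_curve[OF assms] continuous_on_cdot[OF assms]) auto

lemma curve_length_nonneg: "\<gamma> \<in> curves a b \<Longrightarrow> 0 \<le> curve_length S \<gamma>"
  unfolding curve_length_def
  by (intro integral_nonneg integrable_continuous_real continuous_on_speed wnorm_nonneg metric_posdef)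

lemma V_dist_le: "\<gamma> \<in> curves xb x \<Longrightarrow> V_dist S x xb \<le> curve_length S \<gamma>"
  unfolding V_dist_def by (rule cINF_lower) (auto intro!: bdd_belowI2 curve_length_nonneg)

lemma curve_length_mono:
  assumes g: "\<gamma> \<in> curves a b" and e: "\<eta> \<in> curves a' b'"
    and le: "\<And>s. s \<in> {0..1} \<Longrightarrow>
      wnorm (metric S (\<eta> s)) (cdot \<eta> s) \<le> c * wnorm (metric S (\<gamma> s)) (cdot \<gamma> s)"
  shows "curve_length S \<eta> \<le> c * curve_length S \<gamma>"
proof -
  have "curve_length S \<eta> \<le> integral {0..1} (\<lambda>s. c * wnorm (metric S (\<gamma> s)) (cdot \<gamma> s))"
    unfolding curve_length_def
    by (intro integral_le integrable_continuous_real continuous_intros continuous_on_speed[OF g]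
        continuous_on_speed[OF e] le)
  then show ?thesis by (simp add: curve_length_def)
qed

lemma segment_length_le:
  assumes "0 \<le> \<alpha>" "\<And>s. s \<in> {0..1} \<Longrightarrow> loewner_le (metric S (a + s *\<^sub>R d)) (\<alpha> *\<^sub>R mat 1)"
  obtains \<gamma> where "\<gamma> \<in> curves a (a + d)" "curve_length S \<gamma> \<le> sqrt \<alpha> * norm d"
proof -
  define \<gamma> where "\<gamma> = (\<lambda>s. a + s *\<^sub>R d)"
  have D: "(\<gamma> has_vector_derivative d) (at s within {0..1})" for s
    unfolding \<gamma>_def by (auto intro!: derivative_eq_intros)
  have \<gamma>: "\<gamma> \<in> curves a (a + d)"
    by (rule curvesI[OF _ _ D]) (auto simp: \<gamma>_def)
  have "curve_length S \<gamma> \<le> integral {0..1} (\<lambda>s::real. sqrt \<alpha> * norm d)"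
    unfolding curve_length_def
  proof (intro integral_le integrable_continuous_real continuous_on_speed[OF \<gamma>])
    show "wnorm (metric S (\<gamma> s)) (cdot \<gamma> s) \<le> sqrt \<alpha> * norm d" if "s \<in> {0..1}" for s
      unfolding cdot_eq[OF D that] using assms(2)[OF that] assms(1)
      by (simp add: \<gamma>_def wnorm_le_of_loewner_le)
  qed auto
  then show ?thesis using that[OF \<gamma>] by simp
qed

text \<open>Each curve is traversed on one half of the interval, slowing down quadratically towards the
  junction; both reparametrisations are defined on the whole interval, so that the join needs no
  case distinction.\<close>

lemma curves_join:
  assumes g: "\<gamma> \<in> curves a b" and e: "\<eta> \<in> curves b c"
  obtains \<zeta> where "\<zeta> \<in> curves a c" "curve_length S \<zeta> = curve_length S \<gamma> + curve_length S \<eta>"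
proof -
  define p :: "real \<Rightarrow> real" where "p = (\<lambda>s. 1 - (max 0 (1 - 2 * s))\<^sup>2)"
  define q :: "real \<Rightarrow> real" where "q = (\<lambda>s. (max 0 (2 * s - 1))\<^sup>2)"
  define p' :: "real \<Rightarrow> real" where "p' = (\<lambda>s. 4 * max 0 (1 - 2 * s))"
  define q' :: "real \<Rightarrow> real" where "q' = (\<lambda>s. 4 * max 0 (2 * s - 1))"
  \<comment> \<open>At each parameter one of the two curves rests at the junction \<open>b\<close>;
    subtracting \<open>b\<close> leaves the other one.\<close>
  define \<zeta> where "\<zeta> = (\<lambda>s. \<gamma> (p s) + \<eta> (q s) - b)"
  define D where "D = (\<lambda>s. p' s *\<^sub>R cdot \<gamma> (p s) + q' s *\<^sub>R cdot \<eta> (q s))"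
  have dp: "(p has_real_derivative p' s) (at s within T)" for s T
  proof (rule has_field_derivative_at_within)
    have "((\<lambda>s. 1 - 2 * s) has_real_derivative -2) (at s)" by (auto intro!: derivative_eq_intros)
    from DERIV_diff[OF DERIV_const[of 1] DERIV_chain2[OF has_real_derivative_ramp_square this]]
    show "(p has_real_derivative p' s) (at s)" by (simp add: p_def p'_def)
  qed
  have dq: "(q has_real_derivative q' s) (at s within T)" for s T
  proof (rule has_field_derivative_at_within)
    have "((\<lambda>s. 2 * s - 1) has_real_derivative 2) (at s)" by (auto intro!: derivative_eq_intros)
    from DERIV_chain2[OF has_real_derivative_ramp_square this]
    show "(q has_real_derivative q' s) (at s)" by (simp add: q_def q'_def)
  qed
  have cp: "continuous_on T p" "continuous_on T q" "continuous_on T p'" "continuous_on T q'" for T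
    unfolding p_def q_def p'_def q'_def by (intro continuous_intros)+
  have rp: "p s \<in> {0..1}" and rq: "q s \<in> {0..1}" if "s \<in> {0..1}" for s
    using that power_le_one[of "max 0 (1 - 2 * s)" 2] power_le_one[of "max 0 (2 * s - 1)" 2]
    by (simp_all add: p_def q_def)
  have imp: "p ` {0..1} \<subseteq> {0..1}" "q ` {0..1} \<subseteq> {0..1}" using rp rq by auto
  have chain: "((\<lambda>s. \<theta> (r s)) has_vector_derivative r' *\<^sub>R cdot \<theta> (r s)) (at s within {0..1})"
    if "\<theta> \<in> curves x y" "(r has_real_derivative r') (at s within {0..1})" "r ` {0..1} \<subseteq> {0..1}" "s \<in> {0..1}"
    for \<theta> :: "real \<Rightarrow> 'nx rvec" and r r' s x y
  proof -
    have "(\<theta> has_vector_derivative cdot \<theta> (r s)) (at (r s) within r ` {0..1})"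
      by (rule has_vector_derivative_within_subset[OF curves_has_cdot[OF that(1)] that(3)])
        (rule subsetD[OF that(3) imageI[OF that(4)]])
    then show ?thesis
      using vector_diff_chain_within[of r r' s "{0..1}" \<theta>] that(2)
      by (simp add: o_def has_real_derivative_iff_has_vector_derivative)
  qed
  have D: "(\<zeta> has_vector_derivative D s) (at s within {0..1})" if "s \<in> {0..1}" for s
    unfolding \<zeta>_def D_def
    using has_vector_derivative_diff[OF has_vector_derivative_add[OF chain[OF g dp imp(1) that]
        chain[OF e dq imp(2) that]] has_vector_derivative_const[of b]] by simp
  have \<zeta>: "\<zeta> \<in> curves a c"
  proof (rule curvesI[OF _ _ D])
    show "\<zeta> 0 = a" "\<zeta> 1 = c"
      by (auto simp: \<zeta>_def p_def q_def curves_endpoints[OF g] curves_endpoints[OF e])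
    show "continuous_on {0..1} D"
      unfolding D_def
      by (intro continuous_intros cp continuous_on_compose2[OF continuous_on_cdot[OF g]]
          continuous_on_compose2[OF continuous_on_cdot[OF e]] imp)
  qed
  let ?w = "\<lambda>\<theta> s. wnorm (metric S (\<theta> s)) (cdot \<theta> s)"
  have speed: "?w \<zeta> s = p' s *\<^sub>R ?w \<gamma> (p s) + q' s *\<^sub>R ?w \<eta> (q s)" if s: "s \<in> {0..1}" for s
  proof (cases "s \<le> 1 / 2")
    case True
    then have "q s = 0" "q' s = 0" "p' s \<ge> 0" by (auto simp: q_def q'_def p'_def)
    moreover from this have "\<zeta> s = \<gamma> (p s)" using curves_endpoints(1)[OF e] by (simp add: \<zeta>_def)
    ultimately show ?thesis using cdot_eq[OF D[OF s] s] by (simp add: D_def wnorm_scaleR)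
  next
    case False
    then have "p s = 1" "p' s = 0" "q' s \<ge> 0" by (auto simp: p_def q'_def p'_def)
    moreover from this have "\<zeta> s = \<eta> (q s)" using curves_endpoints(2)[OF g] by (simp add: \<zeta>_def)
    ultimately show ?thesis using cdot_eq[OF D[OF s] s] by (simp add: D_def wnorm_scaleR)
  qed
  have "((\<lambda>s. p' s *\<^sub>R ?w \<gamma> (p s)) has_integral integral {p 0..p 1} (?w \<gamma>)) {0..1}"
    by (rule has_integral_substitution[OF _ _ imp(1) continuous_on_speed[OF g] dp]) (auto simp: p_def)
  moreover have "((\<lambda>s. q' s *\<^sub>R ?w \<eta> (q s)) has_integral integral {q 0..q 1} (?w \<eta>)) {0..1}"
    by (rule has_integral_substitution[OF _ _ imp(2) continuous_on_speed[OF e] dq]) (auto simp: q_def)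
  ultimately have "((\<lambda>s. p' s *\<^sub>R ?w \<gamma> (p s) + q' s *\<^sub>R ?w \<eta> (q s)) has_integral
      (integral {p 0..p 1} (?w \<gamma>) + integral {q 0..q 1} (?w \<eta>))) {0..1}"
    by (rule has_integral_add)
  moreover have "integral {p 0..p 1} (?w \<gamma>) = curve_length S \<gamma>" "integral {q 0..q 1} (?w \<eta>) = curve_length S \<eta>"
    by (auto simp: p_def q_def curve_length_def)
  ultimately have "(?w \<zeta> has_integral (curve_length S \<gamma> + curve_length S \<eta>)) {0..1}"
    using has_integral_cong[of "{0..1}" "?w \<zeta>", OF speed] by simp
  then have "curve_length S \<zeta> = curve_length S \<gamma> + curve_length S \<eta>"
    unfolding curve_length_def[of S \<zeta>] by (rule integral_unique)
  then show ?thesis using that[OF \<zeta>] by blast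
qed

lemma geodesic_curve:
  assumes "geodesics S"
  shows "geo S xb x \<in> curves xb x" "curve_length S (geo S xb x) = V_dist S x xb"
proof -
  have *: "geo S xb x \<in> curves xb x" "\<And>\<gamma>. \<gamma> \<in> curves xb x \<Longrightarrow> curve_length S (geo S xb x) \<le> curve_length S \<gamma>"
    using assms by (auto simp: geodesics_def is_arg_min_def not_less)
  then show "geo S xb x \<in> curves xb x" by blast
  show "curve_length S (geo S xb x) = V_dist S x xb"
  proof (rule antisym)
    show "curve_length S (geo S xb x) \<le> V_dist S x xb"
      unfolding V_dist_def using * by (intro cINF_greatest) auto
  qed (rule V_dist_le[OF *(1)])
qed

end

section \<open>The uncertain predictor\<close>

lemma continuous_on_blinfun_pointwise:
  "continuous_on T D \<Longrightarrow> continuous_on T g \<Longrightarrow> continuous_on T (\<lambda>x. blinfun_apply (D x) (g x))"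
  by (rule bounded_bilinear.continuous_on[OF bounded_bilinear_blinfun_apply])

lemma sum_Plus_UNIV:
  fixes f :: "'a::finite + 'b::finite \<Rightarrow> 'c::comm_monoid_add"
  shows "sum f UNIV = (\<Sum>a\<in>UNIV. f (Inl a)) + (\<Sum>b\<in>UNIV. f (Inr b))"
  by (simp add: sum.Plus flip: UNIV_Plus_UNIV)

text \<open>One coordinate of the mixed-product rule for Kronecker products.\<close>

lemma row_kron_mult_vec_kron: "(\<Sum>p\<in>UNIV. row_kron v (mat 1) $ i $ p * vec_kron a c $ p) = (v \<bullet> a) * c $ i"
proof -
  have "(\<Sum>p\<in>UNIV. row_kron v (mat 1) $ i $ p * vec_kron a c $ p)
    = (\<Sum>k\<in>UNIV. \<Sum>l\<in>UNIV. if l = i then v $ k * a $ k * c $ l else 0)"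
    unfolding sum.cartesian_product UNIV_Times_UNIV
    by (rule sum.cong) (auto simp: row_kron_def vec_kron_def mat_def split: prod.splits)
  also have "\<dots> = (v \<bullet> a) * c $ i" by (simp add: inner_vec_def sum_distrib_right)
  finally show ?thesis .
qed

lemma norm_Inl_part_le:
  fixes y :: "real^'n" and z :: "real^('n::finite + 'm::finite)"
  assumes "\<And>i. y $ i = z $ Inl i"
  shows "norm y \<le> norm z"
proof -
  have "y \<bullet> y \<le> z \<bullet> z"
    unfolding inner_vec_def sum_Plus_UNIV assms by (simp add: sum_nonneg)
  then show ?thesis by (simp add: norm_eq_sqrt_inner)
qed

lemma hcat_mat_1_0: "(hcat (mat 1) 0 *v z) $ i = z $ Inl i"
proof -
  have "(hcat (mat 1) 0 *v z) $ i = (mat 1 *v (\<chi> a. z $ Inl a)) $ i"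
    unfolding matrix_vector_mult_def vec_lambda_beta sum_Plus_UNIV
    by (simp add: hcat_def stack_def)
  then show ?thesis by simp
qed

context
  fixes S :: "('nx::{finite,linorder}, 'ne::finite, 'nu::finite, 'nc::finite, 'd::finite) mpc"
begin

text \<open>The mixed-product rule on both blocks. The disturbance thus acts as a scalar times the
  direction \<open>c\<close>, the form in which all later arguments use it.\<close>

lemma E_mat_mult:
  "E_mat S x u *v stack (vec_kron a c) (vec_kron b c)
    = (c_x S * (Phi_hat S x \<bullet> a) + c_u S * (u \<bullet> b)) *\<^sub>R c" (is "?l = ?r")
proof -
  have "?l $ i = ?r $ i" for i
    unfolding matrix_vector_mult_def vec_lambda_beta sum_Plus_UNIV
    using row_kron_mult_vec_kron[of "Phi_hat S x" i a c] row_kron_mult_vec_kron[of u i b c]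
    by (simp add: E_mat_def hcat_def stack_def algebra_simps flip: sum_distrib_left)
  then show ?thesis by (simp add: vec_eq_iff)
qed

lemma D_setE:
  assumes "w \<in> D_set"
  obtains a b c where "w = stack (vec_kron a c) (vec_kron b c)" "norm a \<le> 1" "norm b \<le> 1" "norm c \<le> 1"
  using assms by (auto simp: D_set_def)

lemma D_setI:
  "norm a \<le> 1 \<Longrightarrow> norm b \<le> 1 \<Longrightarrow> norm c \<le> 1 \<Longrightarrow> stack (vec_kron a c) (vec_kron b c) \<in> D_set"
  by (auto simp: D_set_def)

text \<open>The first components of the lifted state are the state itself, so the prediction error
  of the state is a subvector of the lifted error.\<close>

lemma model_mismatch_le: "norm (F_true S x u - F_hat S x u) \<le> norm (model_error S x u)"
  by (rule norm_Inl_part_le) (simp add: model_error_def F_hat_def hcat_mat_1_0 Phi_hat_def stack_def)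

text \<open>Aligning the two scalar factors with \<open>Phi_hat S x\<close> and \<open>u\<close>
  makes the scalar equal to the full radius \<open>r\<close>; the common factor \<open>c\<close>
  supplies the direction of \<open>y\<close>.\<close>

lemma ball_eq_E_mat_D_set:
  assumes "norm y \<le> c_x S * norm (Phi_hat S x) + c_u S * norm u"
  obtains w where "w \<in> D_set" "E_mat S x u *v w = y"
proof -
  define r where "r = c_x S * norm (Phi_hat S x) + c_u S * norm u"
  \<comment> \<open>For \<open>r = 0\<close> the division yields \<open>c = 0\<close>, which is
    right because \<open>y\<close> is then 0.\<close>
  define c where "c = y /\<^sub>R r"
  have sgn: "v \<bullet> sgn v = norm v" for v :: "real^'k"
    by (cases "v = 0") (simp_all add: sgn_div_norm power2_norm_eq_inner[symmetric] power2_eq_square)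
  have "norm y \<le> r" using assms by (simp add: r_def)
  then have "r \<ge> 0" using norm_ge_zero order_trans by blast
  have "norm c \<le> 1" using \<open>norm y \<le> r\<close> \<open>r \<ge> 0\<close> by (simp add: c_def divide_simps)
  then have "stack (vec_kron (sgn (Phi_hat S x)) c) (vec_kron (sgn u) c) \<in> D_set"
    by (intro D_setI) (auto simp: norm_sgn)
  moreover have "r *\<^sub>R c = y" using \<open>norm y \<le> r\<close> by (cases "r = 0") (auto simp: c_def)
  ultimately show ?thesis using that by (simp add: E_mat_mult sgn r_def)
qed

text \<open>For \<open>w\<close> in product form, \<open>E_mat_mult\<close> makes the predictor an
  explicit expression in \<open>Phi_hat\<close> and the input, open to the sum and product rules.
  Continuity of the derivative is stated along paths of points and directions, as needed for the
  velocity of the image curve.\<close>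

lemma f_w_C1:
  assumes feat: "\<And>l. C1 (feature S l)" and w: "w \<in> D_set"
  obtains D where "\<And>p. ((\<lambda>p. f_w S (fst p) (snd p) w) has_derivative D p) (at p)"
    and "\<And>T \<theta> h. continuous_on T \<theta> \<Longrightarrow> continuous_on T h \<Longrightarrow> continuous_on T (\<lambda>s. D (\<theta> s) (h s))"
proof -
  obtain d where d: "\<And>l x. (feature S l has_derivative blinfun_apply (d l x)) (at x)"
    and dc: "\<And>l. continuous_on UNIV (d l)"
    using feat unfolding C1_def by metis
  obtain a b c where w: "w = stack (vec_kron a c) (vec_kron b c)"
    using w by (rule D_setE)
  define P :: "'nx rvec \<Rightarrow> 'nx rvec \<Rightarrow> real^('nx + 'ne)" where
    "P = (\<lambda>x h. stack h (\<chi> l. d l x h))"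
  have P: "(Phi_hat S has_derivative P x) (at x)" for x
  proof (rule has_derivative_vec)
    fix k show "((\<lambda>x. Phi_hat S x $ k) has_derivative (\<lambda>h. P x h $ k)) (at x)"
      using d by (cases k)
        (auto simp: Phi_hat_def P_def stack_def intro!: bounded_linear_imp_has_derivative)
  qed
  have Pc: "continuous_on T (\<lambda>s. P (\<theta> s) (h s))" if "continuous_on T \<theta>" "continuous_on T h"
    for T :: "'z::topological_space set" and \<theta> h
  proof -
    have "P (\<theta> s) (h s) = (\<chi> k. case k of Inl i \<Rightarrow> h s $ i | Inr l \<Rightarrow> d l (\<theta> s) (h s))" for s
      by (simp add: P_def stack_def cong: sum.case_cong)
    moreover have "continuous_on T (\<lambda>s. \<chi> k. case k of Inl i \<Rightarrow> h s $ i | Inr l \<Rightarrow> d l (\<theta> s) (h s))"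
    proof (rule continuous_on_vec_lambda)
      fix k show "continuous_on T (\<lambda>s. case k of Inl i \<Rightarrow> h s $ i | Inr l \<Rightarrow> d l (\<theta> s) (h s))"
        using that by (cases k)
          (auto intro!: continuous_intros continuous_on_blinfun_pointwise continuous_on_compose2[OF dc])
    qed
    ultimately show ?thesis by simp
  qed
  have Phic: "continuous_on T (\<lambda>s. Phi_hat S (\<theta> s))" if "continuous_on T \<theta>"
    for T :: "'z::topological_space set" and \<theta>
  proof (rule continuous_on_compose2[OF _ that])
    show "continuous_on UNIV (Phi_hat S)" by (rule has_derivative_continuous_on) (rule P)
  qed simp
  define D :: "'nx rvec \<times> 'nu rvec \<Rightarrow> 'nx rvec \<times> 'nu rvec \<Rightarrow> 'nx rvec" where
    "D = (\<lambda>p h. hcat (mat 1) 0 *v (A_mat S *v P (fst p) (fst h) + B0 S *v snd h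
      + (\<Sum>i\<in>UNIV. (B_mat S i - A_mat S) *v (snd p $ i *\<^sub>R P (fst p) (fst h) + snd h $ i *\<^sub>R Phi_hat S (fst p))))
      + (c_x S * (P (fst p) (fst h) \<bullet> a) + c_u S * (snd h \<bullet> b)) *\<^sub>R c)"
  have P': "((\<lambda>p. Phi_hat S (fst p)) has_derivative (\<lambda>h. P (fst p) (fst h))) (at p)" for p :: "'nx rvec \<times> 'nu rvec"
    by (rule has_derivative_compose[OF bounded_linear_imp_has_derivative[OF bounded_linear_fst] P])
  have mv: "((\<lambda>p. Q *v g p) has_derivative (\<lambda>h. Q *v g' h)) (at p)"
    if "(g has_derivative g') (at p)" for g g' p and Q :: "real^'k^'m"
    using bounded_linear.has_derivative[OF matrix_vector_mul_bounded_linear that] .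
  have sn: "((\<lambda>p. snd p $ i) has_derivative (\<lambda>h. snd h $ i)) (at p)" for p :: "'nx rvec \<times> 'nu rvec" and i
    by (rule bounded_linear_imp_has_derivative[OF bounded_linear_compose[OF bounded_linear_vec_nth bounded_linear_snd]])
  show ?thesis
  proof (rule that)
    show "((\<lambda>p. f_w S (fst p) (snd p) w) has_derivative D p) (at p)" for p
      unfolding f_w_def w E_mat_mult F_hat_def lifted_pred_def D_def
      by (rule has_derivative_add mv has_derivative_sum has_derivative_scaleR_left has_derivative_scaleR
          has_derivative_mult_right has_derivative_inner_left P' sn
          bounded_linear_imp_has_derivative[OF bounded_linear_snd])+
    show "continuous_on T (\<lambda>s. D (\<theta> s) (h s))" if "continuous_on T \<theta>" "continuous_on T h"
      for T :: "'z::topological_space set" and \<theta> h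
      unfolding D_def
      by (intro continuous_intros continuous_on_matrix_vector Pc Phic that)
  qed
qed

text \<open>The joint derivative is the sum of its partials, and \<open>(v, gain S x *v v)\<close>
  is the tangent of the lifted geodesic when \<open>v\<close> is the velocity of the
  geodesic.\<close>

lemma A_cl_mult:
  assumes "((\<lambda>p. f_w S (fst p) (snd p) w) has_derivative D) (at (x, u))"
  shows "A_cl S x u w *v v = D (v, gain S x *v v)"
  using has_derivative_sections[OF assms, THEN jacobian_apply]
    has_derivative_pair_split[OF assms, of v "gain S x *v v"]
  by (simp only: A_cl_def matrix_vector_mult_add_rdistrib matrix_vector_mul_assoc[symmetric])

text \<open>The same splitting for the constraints.\<close>

lemma constr_grad_inner:
  assumes "((\<lambda>p. constr S j (fst p) (snd p)) has_derivative D) (at (x, u))"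
  shows "constr_grad S j x u \<bullet> v = D (v, gain S x *v v)"
  using has_derivative_sections[OF assms, THEN grad_inner]
    has_derivative_pair_split[OF assms, of v "gain S x *v v"]
  by (simp only: constr_grad_def inner_add_left dot_lmul_matrix)

end

section \<open>One step of the closed loop\<close>

locale tube_mpc =
  fixes S :: "('nx::{finite,linorder}, 'ne::finite, 'nu::finite, 'nc::finite, 'd::finite) mpc"
  assumes true_system: "true_system S"
    and learned_model: "learned_model S"
    and geodesics: "geodesics S"
    and cost_weights: "cost_weights S"
    and horizon_pos: "horizon S \<ge> 1"
    and tightening_regular: "tightening_regular S"
    and RCCM: "RCCM S"
    and terminal_condition: "terminal_condition S"
    and PEB: "PEB S"
begin

section \<open>Consequences of the standing assumptions\<close>

lemma metric_posdef: "posdef (metric S x)"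
  using RCCM by (simp add: RCCM_def)

lemma metric_continuous: "continuous_on T (metric S)"
  using RCCM by (intro C1_continuous) (simp add: RCCM_def)

lemma gain_continuous: "continuous_on T (gain S)"
  using RCCM continuous_on_subset by (auto simp: RCCM_def)

lemma coefficients_nonneg: "0 \<le> c_x S" "0 \<le> c_u S" "0 < rho_c S" "rho_c S < 1" "0 < alpha1 S" "0 < alpha2 S"
  using RCCM PEB by (auto simp: RCCM_def PEB_def)

lemma RCCM_D:
  assumes "(x, u) \<in> Z_set S" "w \<in> D_set"
  shows "loewner_le (transpose (A_cl S x u w) ** metric S (f_w S x u w) ** A_cl S x u w)
      ((1 - rho_c S) *\<^sub>R metric S x)"
    and "loewner_le (alpha1 S *\<^sub>R mat 1) (metric S x)"
    and "loewner_le (metric S (f_w S x u w)) (alpha2 S *\<^sub>R mat 1)"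
  using RCCM assms unfolding RCCM_def by blast+

lemma constr_derivative:
  obtains D where "\<And>p. ((\<lambda>p. constr S j (fst p) (snd p)) has_derivative blinfun_apply (D p)) (at p)"
    "continuous_on UNIV D"
proof -
  have "C1 (\<lambda>p. constr S j (fst p) (snd p))" using true_system by (simp add: true_system_def)
  then show ?thesis using that unfolding C1_def by blast
qed

text \<open>Each component is the joint derivative of the constraint in the direction of a lifted
  basis vector. Continuity bounds the gradient on the compact set \<open>Z_set\<close>.\<close>

lemma continuous_on_constr_grad: "continuous_on T (\<lambda>p. constr_grad S j (fst p) (snd p))"
proof -
  obtain D where D: "\<And>p. ((\<lambda>p. constr S j (fst p) (snd p)) has_derivative blinfun_apply (D p)) (at p)"
    and Dc: "continuous_on UNIV D" by (rule constr_derivative[of j]) blast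
  have "constr_grad S j (fst p) (snd p) = (\<chi> i. D p (axis i 1, gain S (fst p) *v axis i 1))" for p
  proof (subst vec_eq_iff, rule allI)
    fix i
    have "constr_grad S j (fst p) (snd p) $ i = constr_grad S j (fst p) (snd p) \<bullet> axis i 1"
      by (simp add: inner_axis)
    also have "\<dots> = D p (axis i 1, gain S (fst p) *v axis i 1)"
      using constr_grad_inner[of S j "D p" "fst p" "snd p"] D by simp
    finally show "constr_grad S j (fst p) (snd p) $ i
      = (\<chi> i. D p (axis i 1, gain S (fst p) *v axis i 1)) $ i" by simp
  qed
  moreover have "continuous_on T (\<lambda>p. \<chi> i. D p (axis i 1, gain S (fst p) *v axis i 1))"
    by (intro continuous_intros continuous_on_blinfun_pointwise continuous_on_matrix_vector
        continuous_on_subset[OF Dc] continuous_on_compose2[OF gain_continuous[of UNIV]]) auto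
  ultimately show ?thesis by simp
qed

lemma tight_upper:
  assumes "(x, u) \<in> Z_set S"
  shows "norm (constr_grad S j x u v* matrix_inv (cholesky (metric S x))) \<le> tight S j"
proof -
  have "compact ((\<lambda>p. constr_grad S j (fst p) (snd p)) ` Z_set S)"
    using true_system by (intro compact_continuous_image continuous_on_constr_grad) (simp add: true_system_def)
  then obtain b where b: "\<And>p. p \<in> Z_set S \<Longrightarrow> norm (constr_grad S j (fst p) (snd p)) \<le> b"
    using compact_imp_bounded bounded_iff by (metis (no_types, lifting) image_eqI)
  \<comment> \<open>\<open>RCCM\<close> states the bound on the metric for pairs of a point and a
    disturbance, so some disturbance must be exhibited.\<close>
  have zero: "stack (vec_kron 0 0) (vec_kron 0 0) \<in> D_set" by (rule D_setI) auto
  have "bdd_above ((\<lambda>(x, u). norm (constr_grad S j x u v* matrix_inv (cholesky (metric S x)))) ` Z_set S)"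
  proof (rule bdd_aboveI2)
    fix p assume p: "p \<in> Z_set S"
    have "norm (constr_grad S j (fst p) (snd p) v* matrix_inv (cholesky (metric S (fst p))))
        \<le> norm (constr_grad S j (fst p) (snd p)) / sqrt (alpha1 S)"
      using p RCCM_D(2)[OF _ zero, of "fst p" "snd p"] coefficients_nonneg
      by (intro norm_cholesky_inverse_le metric_posdef) auto
    also have "\<dots> \<le> b / sqrt (alpha1 S)"
      using b[OF p] coefficients_nonneg by (intro divide_right_mono) auto
    finally show "(case p of (x, u) \<Rightarrow> norm (constr_grad S j x u v* matrix_inv (cholesky (metric S x))))
        \<le> b / sqrt (alpha1 S)" by (simp add: case_prod_beta)
  qed
  from cSUP_upper[OF assms this] show ?thesis by (simp add: tight_def)
qed

text \<open>\<open>Z_set\<close> contains the origin, so the supremum dominates at least one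
  norm.\<close>

lemma tight_nonneg: "0 \<le> tight S j"
proof -
  have "(0, 0) \<in> Z_set S" using true_system by (auto simp: true_system_def Z_set_def less_imp_le)
  from tight_upper[OF this] show ?thesis using norm_ge_zero order_trans by blast
qed

lemma gamma_u_derivative:
  assumes "\<gamma> \<in> curves xb x" "s \<in> {0..1}"
  shows "((\<lambda>s. ub + integral {0..s} (\<lambda>s'. gain S (\<gamma> s') *v cdot \<gamma> s'))
    has_vector_derivative gain S (\<gamma> s) *v cdot \<gamma> s) (at s within {0..1})"
proof -
  have "continuous_on {0..1} (\<lambda>s'. gain S (\<gamma> s') *v cdot \<gamma> s')"
    by (intro continuous_on_matrix_vector continuous_on_compose2[OF gain_continuous[of UNIV]]
        continuous_on_curve[OF assms(1)] continuous_on_cdot[OF assms(1)]) auto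
  from has_vector_derivative_add[OF has_vector_derivative_const integral_has_vector_derivative[OF this assms(2)]]
  show ?thesis by simp
qed

text \<open>An instance of \<open>barrier_continuation\<close>: the constraints along the lifted
  curve against the Riemannian speed, whose integral is the length in \<open>init\<close>. The case
  of a vanishing constant rests on \<open>tightening_regular\<close>.\<close>

lemma curve_in_Z:
  assumes \<gamma>: "\<gamma> \<in> curves xb x"
    and init: "\<And>j. constr S j xb ub + tight S j * curve_length S \<gamma> \<le> 0"
    and \<eta>0: "\<eta> 0 = ub"
    and \<eta>: "\<And>s. s \<in> {0..1} \<Longrightarrow> (\<eta> has_vector_derivative gain S (\<gamma> s) *v cdot \<gamma> s) (at s within {0..1})"
    and s: "s \<in> {0..1}"
  shows "(\<gamma> s, \<eta> s) \<in> Z_set S"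
proof -
  let ?w = "\<lambda>s. wnorm (metric S (\<gamma> s)) (cdot \<gamma> s)"
  let ?H = "\<lambda>j s. constr S j (\<gamma> s) (\<eta> s)"
  let ?G = "\<lambda>j s. constr_grad S j (\<gamma> s) (\<eta> s) \<bullet> cdot \<gamma> s"
  have cont: "continuous_on {0..1} (\<lambda>s. (\<gamma> s, \<eta> s))"
    by (intro continuous_on_Pair continuous_on_curve[OF \<gamma>] continuous_on_vector_derivative[OF \<eta>])
  have "?H j s \<le> 0" for j
  proof (rule barrier_continuation[where w = ?w and c = "tight S" and G = ?G and H = ?H])
    show "continuous_on {0..1} ?w"
      using continuous_on_speed[OF metric_posdef metric_continuous \<gamma>] .
    show "0 \<le> ?w t" for t by (intro wnorm_nonneg metric_posdef)
    show "0 \<le> tight S j" for j by (rule tight_nonneg)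
    show "(?H j has_vector_derivative ?G j t) (at t within {0..1})" if "t \<in> {0..1}" for j t
    proof -
      obtain D where D: "\<And>p. ((\<lambda>p. constr S j (fst p) (snd p)) has_derivative blinfun_apply (D p)) (at p)"
        by (rule constr_derivative[of j]) blast
      have "((\<lambda>s. (\<gamma> s, \<eta> s)) has_vector_derivative (cdot \<gamma> t, gain S (\<gamma> t) *v cdot \<gamma> t)) (at t within {0..1})"
        by (intro has_vector_derivative_Pair curves_has_cdot[OF \<gamma>] \<eta> that)
      from vector_derivative_diff_chain_within[OF this has_derivative_at_withinI[OF D]]
      show ?thesis by (simp add: o_def constr_grad_inner[OF D])
    qed
    \<comment> \<open>\<open>tight\<close> controls the gradient only on \<open>Z_set\<close>; the
      assumed signs of all constraints put the point there.\<close>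
    show "?G j t \<le> tight S j * ?w t" if "\<forall>i. ?H i t \<le> 0" for j t
    proof -
      have "(\<gamma> t, \<eta> t) \<in> Z_set S" using that by (simp add: Z_set_def)
      then show ?thesis
        using inner_le_cholesky[OF metric_posdef, of "constr_grad S j (\<gamma> t) (\<eta> t)" "cdot \<gamma> t" "\<gamma> t"]
          mult_right_mono[OF tight_upper[of "\<gamma> t" "\<eta> t" j] wnorm_nonneg[OF metric_posdef, of "\<gamma> t" "cdot \<gamma> t"]]
        by linarith
    qed
    show "?G j t = 0" if "?w t = 0" for j t
      using that wnorm_eq_0[OF metric_posdef] by simp
    show "\<exists>d>0. \<forall>r\<in>{0..1}. \<bar>r - t\<bar> < d \<longrightarrow> ?G j r = 0"
      if t: "t \<in> {0..1}" and "\<forall>i. ?H i t \<le> 0" "?H j t = 0" "tight S j = 0" for j t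
    proof -
      have "(\<gamma> t, \<eta> t) \<in> Z_set S" using that by (simp add: Z_set_def)
      then have "\<forall>\<^sub>F p in nhds (\<gamma> t, \<eta> t). constr_grad S j (fst p) (snd p) = 0"
        using tightening_regular that unfolding tightening_regular_def by blast
      then obtain e where e: "e > 0" "\<And>p. dist p (\<gamma> t, \<eta> t) < e \<Longrightarrow> constr_grad S j (fst p) (snd p) = 0"
        unfolding eventually_nhds_metric by blast
      obtain d where "d > 0" "\<And>r. r \<in> {0..1} \<Longrightarrow> dist r t < d \<Longrightarrow> dist (\<gamma> r, \<eta> r) (\<gamma> t, \<eta> t) < e"
        using cont t \<open>e > 0\<close> unfolding continuous_on_iff by blast
      then show ?thesis using e(2) by (intro exI[of _ d]) (auto simp: dist_real_def)
    qed
    show "?H j 0 + tight S j * integral {0..1} ?w \<le> 0" for j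
      using init[of j] curves_endpoints(1)[OF \<gamma>] \<eta>0 by (simp add: curve_length_def)
  qed (rule s)
  then show ?thesis by (simp add: Z_set_def)
qed

lemma closed_loop_step:
  assumes init: "\<And>j. constr S j xb ub + tight S j * V_dist S x xb \<le> 0"
  shows "V_dist S (F_true S x (kappa S x xb ub)) (F_hat S xb ub) \<le> tube_next S xb ub (V_dist S x xb)"
proof -
  define \<gamma> where "\<gamma> = geo S xb x"
  have \<gamma>: "\<gamma> \<in> curves xb x" and len: "curve_length S \<gamma> = V_dist S x xb"
    using geodesic_curve[OF metric_posdef metric_continuous geodesics] by (auto simp: \<gamma>_def)
  define \<eta> where "\<eta> = gamma_u S x xb ub"
  have \<eta>0: "\<eta> 0 = ub" by (simp add: \<eta>_def gamma_u_def)
  have \<eta>: "(\<eta> has_vector_derivative gain S (\<gamma> s) *v cdot \<gamma> s) (at s within {0..1})" if "s \<in> {0..1}" for s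
    using gamma_u_derivative[OF \<gamma> that, of ub] by (simp add: \<eta>_def \<gamma>_def gamma_u_def[abs_def])
  have Z: "(\<gamma> s, \<eta> s) \<in> Z_set S" if "s \<in> {0..1}" for s
    using curve_in_Z[OF \<gamma> _ \<eta>0 \<eta> that] init by (simp add: len)
  define u where "u = kappa S x xb ub"
  \<comment> \<open>The end of the lifted geodesic is the true state with the applied input, so the
    proportional error bound becomes available there.\<close>
  have Zb: "(xb, ub) \<in> Z_set S" and Zx: "(x, u) \<in> Z_set S"
    using Z[of 0] Z[of 1] curves_endpoints[OF \<gamma>] \<eta>0 by (auto simp: u_def kappa_def \<eta>_def)
  then have "norm (model_error S x u) \<le> c_x S * norm (Phi_hat S x) + c_u S * norm u"
    using PEB true_system by (auto simp: PEB_def true_system_def)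
  then have "norm (F_true S x u - F_hat S x u) \<le> c_x S * norm (Phi_hat S x) + c_u S * norm u"
    using model_mismatch_le order_trans by blast
  then obtain w where w: "w \<in> D_set" and "E_mat S x u *v w = F_true S x u - F_hat S x u"
    by (rule ball_eq_E_mat_D_set)
  then have Fw: "f_w S x u w = F_true S x u" by (simp add: f_w_def)
  have feat: "C1 (feature S l)" for l using learned_model by (simp add: learned_model_def)
  obtain D where D: "\<And>p. ((\<lambda>p. f_w S (fst p) (snd p) w) has_derivative D p) (at p)"
    and Dc: "\<And>(T :: real set) \<theta> h. continuous_on T \<theta> \<Longrightarrow> continuous_on T h \<Longrightarrow>
      continuous_on T (\<lambda>s. D (\<theta> s) (h s))"
    by (rule f_w_C1[OF feat w]) blast
  define \<zeta> where "\<zeta> = (\<lambda>s. f_w S (\<gamma> s) (\<eta> s) w)"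
  let ?v = "\<lambda>s. (cdot \<gamma> s, gain S (\<gamma> s) *v cdot \<gamma> s)"
  have \<zeta>': "(\<zeta> has_vector_derivative D (\<gamma> s, \<eta> s) (?v s)) (at s within {0..1})" if "s \<in> {0..1}" for s
  proof -
    have "((\<lambda>s. (\<gamma> s, \<eta> s)) has_vector_derivative ?v s) (at s within {0..1})"
      by (intro has_vector_derivative_Pair curves_has_cdot[OF \<gamma>] \<eta> that)
    from vector_derivative_diff_chain_within[OF this has_derivative_at_withinI[OF D]]
    show ?thesis by (simp add: o_def \<zeta>_def)
  qed
  have \<zeta>: "\<zeta> \<in> curves (f_w S xb ub w) (F_true S x u)"
  proof (rule curvesI[OF _ _ \<zeta>'])
    show "\<zeta> 0 = f_w S xb ub w" "\<zeta> 1 = F_true S x u"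
      using curves_endpoints[OF \<gamma>] \<eta>0 Fw by (auto simp: \<zeta>_def u_def kappa_def \<eta>_def)
    show "continuous_on {0..1} (\<lambda>s. D (\<gamma> s, \<eta> s) (?v s))"
      by (intro Dc continuous_on_Pair continuous_on_matrix_vector continuous_on_curve[OF \<gamma>]
          continuous_on_vector_derivative[OF \<eta>] continuous_on_cdot[OF \<gamma>]
          continuous_on_compose2[OF gain_continuous[of UNIV]]) auto
  qed
  have contraction: "curve_length S \<zeta> \<le> sqrt (1 - rho_c S) * curve_length S \<gamma>"
  proof (rule curve_length_mono[OF metric_posdef metric_continuous \<gamma> \<zeta>])
    fix s :: real assume s: "s \<in> {0..1}"
    have "cdot \<zeta> s = A_cl S (\<gamma> s) (\<eta> s) w *v cdot \<gamma> s"
      using cdot_eq[OF \<zeta>'[OF s] s] A_cl_mult[OF D] by simp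
    then show "wnorm (metric S (\<zeta> s)) (cdot \<zeta> s)
        \<le> sqrt (1 - rho_c S) * wnorm (metric S (\<gamma> s)) (cdot \<gamma> s)"
      using wnorm_contraction[OF RCCM_D(1)[OF Z[OF s] w]] by (simp add: \<zeta>_def)
  qed
  obtain a b c where abc: "w = stack (vec_kron a c) (vec_kron b c)" "norm a \<le> 1" "norm b \<le> 1" "norm c \<le> 1"
    using w by (rule D_setE)
  define y where "y = E_mat S xb ub *v w"
  have "norm y \<le> c_x S * norm (Phi_hat S xb) + c_u S * norm ub"
  proof -
    have "\<bar>Phi_hat S xb \<bullet> a\<bar> \<le> norm (Phi_hat S xb)"
      using Cauchy_Schwarz_ineq2[of "Phi_hat S xb" a] abc(2) mult_left_le[of "norm a" "norm (Phi_hat S xb)"] by simp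
    then have 1: "\<bar>c_x S * (Phi_hat S xb \<bullet> a)\<bar> \<le> c_x S * norm (Phi_hat S xb)"
      using coefficients_nonneg by (simp add: abs_mult mult_left_mono)
    have "\<bar>ub \<bullet> b\<bar> \<le> norm ub"
      using Cauchy_Schwarz_ineq2[of ub b] abc(3) mult_left_le[of "norm b" "norm ub"] by simp
    then have 2: "\<bar>c_u S * (ub \<bullet> b)\<bar> \<le> c_u S * norm ub"
      using coefficients_nonneg by (simp add: abs_mult mult_left_mono)
    let ?r = "c_x S * (Phi_hat S xb \<bullet> a) + c_u S * (ub \<bullet> b)"
    have "norm y = \<bar>?r\<bar> * norm c" by (simp add: y_def abc(1) E_mat_mult)
    also have "\<dots> \<le> \<bar>?r\<bar>" using abc(4) by (intro mult_left_le) auto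
    finally show ?thesis using 1 2 by linarith
  qed
  then have y: "sqrt (alpha2 S) * norm y \<le> sqrt (alpha2 S) * (c_x S * norm (Phi_hat S xb) + c_u S * norm ub)"
    using coefficients_nonneg by (intro mult_left_mono) auto
  \<comment> \<open>\<open>RCCM\<close> bounds the metric only at predictor values. Shrinking the
    factor \<open>c\<close> by \<open>s\<close> stays within \<open>D_set\<close>, so every point of
    the segment is such a value at \<open>(xb, ub)\<close>.\<close>
  have seg: "loewner_le (metric S (F_hat S xb ub + s *\<^sub>R y)) (alpha2 S *\<^sub>R mat 1)" if "s \<in> {0..1}" for s
  proof -
    define w' where "w' = stack (vec_kron a (s *\<^sub>R c)) (vec_kron b (s *\<^sub>R c))"
    have "w' \<in> D_set"
      unfolding w'_def using abc that by (intro D_setI) (auto intro: mult_le_one)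
    moreover have "f_w S xb ub w' = F_hat S xb ub + s *\<^sub>R y"
      by (simp add: f_w_def w'_def y_def abc(1) E_mat_mult mult.commute)
    ultimately show ?thesis using RCCM_D(3)[OF Zb] by metis
  qed
  obtain \<theta> where \<theta>: "\<theta> \<in> curves (F_hat S xb ub) (F_hat S xb ub + y)"
    "curve_length S \<theta> \<le> sqrt (alpha2 S) * norm y"
    using segment_length_le[OF metric_posdef metric_continuous _ seg] coefficients_nonneg by auto
  have "F_hat S xb ub + y = f_w S xb ub w" by (simp add: f_w_def y_def)
  then obtain \<xi> where "\<xi> \<in> curves (F_hat S xb ub) (F_true S x u)"
    "curve_length S \<xi> = curve_length S \<theta> + curve_length S \<zeta>"
    using curves_join[OF metric_posdef metric_continuous, of \<theta> _ _ \<zeta>] \<theta>(1) \<zeta> by metis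
  then show ?thesis
    using V_dist_le[OF metric_posdef metric_continuous, of \<xi>] contraction y \<theta>(2) len
    by (fastforce simp: tube_next_def u_def)
qed

end

section \<open>Recursive feasibility and convergence\<close>

text \<open>The weighted norm attains a positive minimum \<open>m\<close> on the compact unit
  sphere, so by homogeneity it dominates \<open>m\<close> times the Euclidean norm.\<close>

lemma posdef_tendsto_0:
  fixes P :: "real^'n^'n"
  assumes P: "posdef P" and lim: "(\<lambda>k. (wnorm P (v k))\<^sup>2) \<longlonglongrightarrow> 0"
  shows "v \<longlonglongrightarrow> 0"
proof -
  have "\<exists>v0\<in>sphere 0 1. \<forall>v\<in>sphere 0 1. wnorm P v0 \<le> wnorm P v"
    by (intro continuous_attains_inf continuous_on_wnorm continuous_intros) auto
  then obtain v0 where v0: "norm v0 = 1" "\<And>v. norm v = 1 \<Longrightarrow> wnorm P v0 \<le> wnorm P v" by auto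
  define m where "m = wnorm P v0"
  have "m > 0" using v0(1) wnorm_nonneg[OF P, of v0] wnorm_eq_0[OF P, of v0] by (auto simp: m_def)
  have m: "m * norm y \<le> wnorm P y" for y
  proof (cases "y = 0")
    case False
    have "wnorm P y = norm y * wnorm P (sgn y)"
      using False by (simp add: sgn_div_norm wnorm_scaleR flip: mult.assoc)
    then show ?thesis using v0(2)[of "sgn y"] False by (simp add: m_def norm_sgn mult.commute)
  qed (use wnorm_nonneg[OF P] in simp)
  have "(\<lambda>k. sqrt ((wnorm P (v k))\<^sup>2) / m) \<longlonglongrightarrow> sqrt 0 / m"
    by (intro tendsto_intros lim) (use \<open>m > 0\<close> in simp)
  then have "(\<lambda>k. wnorm P (v k) / m) \<longlonglongrightarrow> 0" using wnorm_nonneg[OF P] by simp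
  moreover have "norm (v k) \<le> wnorm P (v k) / m" for k
    using m[of "v k"] \<open>m > 0\<close> by (simp add: field_simps)
  ultimately show ?thesis by (intro Lim_null_comparison[of v]) auto
qed

text \<open>\<open>J\<close> is nonincreasing and bounded below, hence convergent, so its decrements
  vanish, and they dominate \<open>c\<close>.\<close>

lemma decrease_tendsto_0:
  fixes J c :: "nat \<Rightarrow> real"
  assumes "\<And>k. 0 \<le> J k" "\<And>k. 0 \<le> c k" "\<And>k. J (Suc k) + c k \<le> J k"
  shows "c \<longlonglongrightarrow> 0"
proof -
  have "decseq J" using assms(2,3) by (intro decseq_SucI) (smt (verit))
  then obtain L where L: "J \<longlonglongrightarrow> L" using decseq_convergent[of J 0] assms(1) by blast
  have "(\<lambda>k. J k - J (Suc k)) \<longlonglongrightarrow> L - L" by (intro tendsto_diff L LIMSEQ_Suc)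
  then have *: "(\<lambda>k. J k - J (Suc k)) \<longlonglongrightarrow> 0" by simp
  show ?thesis
  proof (rule Lim_null_comparison[OF _ *])
    have "\<bar>c k\<bar> \<le> J k - J (Suc k)" for k using assms(2,3)[of k] by linarith
    then show "\<forall>\<^sub>F k in sequentially. norm (c k) \<le> J k - J (Suc k)" by simp
  qed
qed

lemma nonneg_summand_tendsto_0:
  fixes f g :: "nat \<Rightarrow> real"
  assumes "f \<longlonglongrightarrow> 0" "\<And>k. 0 \<le> g k" "\<And>k. g k \<le> f k"
  shows "g \<longlonglongrightarrow> 0"
  using assms by (intro tendsto_sandwich[OF _ _ tendsto_const assms(1)]) auto

context tube_mpc
begin

section \<open>Monotonicity of tubes and costs, and the shifted plan\<close>

lemma V_dist_nonneg: "0 \<le> V_dist S x xb"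
  using geodesic_curve[OF metric_posdef metric_continuous geodesics]
    curve_length_nonneg[OF metric_posdef metric_continuous] by metis

lemma tube_next_mono: "\<delta> \<le> \<delta>' \<Longrightarrow> tube_next S xb ub \<delta> \<le> tube_next S xb ub \<delta>'"
  using coefficients_nonneg by (simp add: tube_next_def mult_left_mono)

lemma tube_next_nonneg: "0 \<le> \<delta> \<Longrightarrow> 0 \<le> tube_next S xb ub \<delta>"
  using coefficients_nonneg by (simp add: tube_next_def)

lemma stage_cost_mono: "0 \<le> \<delta> \<Longrightarrow> \<delta> \<le> \<delta>' \<Longrightarrow> stage_cost S xb ub \<delta> \<le> stage_cost S xb ub \<delta>'"
  using cost_weights by (simp add: stage_cost_def cost_weights_def mult_left_mono power_mono)

lemma stage_cost_ge:
  "(wnorm (Q_mat S) xb)\<^sup>2 \<le> stage_cost S xb ub \<delta>"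
  "(wnorm (R_mat S) ub)\<^sup>2 \<le> stage_cost S xb ub \<delta>"
  "lam S * \<delta>\<^sup>2 \<le> stage_cost S xb ub \<delta>"
  using cost_weights by (simp_all add: stage_cost_def cost_weights_def)

lemma stage_cost_nonneg: "0 \<le> stage_cost S xb ub \<delta>"
  using stage_cost_ge(1) zero_le_power2 order_trans by blast

lemma terminal_D:
  assumes "(xb, \<delta>) \<in> term_set S"
  shows "(F_hat S xb (k_f S xb), tube_next S xb (k_f S xb) \<delta>) \<in> term_set S"
    and "constr S j xb (k_f S xb) + tight S j * \<delta> \<le> 0"
    and "stage_cost S xb (k_f S xb) \<delta>
      \<le> l_f S xb \<delta> - l_f S (F_hat S xb (k_f S xb)) (tube_next S xb (k_f S xb) \<delta>)"
    and "\<lbrakk>0 \<le> \<delta>'; \<delta>' \<le> \<delta>\<rbrakk> \<Longrightarrow> (xb, \<delta>') \<in> term_set S"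
    and "\<lbrakk>0 \<le> \<delta>'; \<delta>' \<le> \<delta>\<rbrakk> \<Longrightarrow> l_f S xb \<delta>' \<le> l_f S xb \<delta>"
  using terminal_condition assms unfolding terminal_condition_def Let_def by fastforce+

lemma recursions_D:
  assumes "recursions S p" "i < horizon S"
  shows "xbar p (Suc i) = F_hat S (xbar p i) (ubar p i)"
    and "tube p (Suc i) = tube_next S (xbar p i) (ubar p i) (tube p i)"
  using assms by (auto simp: recursions_def)

lemma tube_nonneg:
  assumes "recursions S p" "0 \<le> tube p 0" "i \<le> horizon S"
  shows "0 \<le> tube p i"
  using assms(3)
proof (induction i)
  case (Suc i)
  then show ?case using recursions_D(2)[OF assms(1), of i] tube_next_nonneg by simp
qed (rule assms(2))

lemma feasible_tube_nonneg: "feasible S x p \<Longrightarrow> i \<le> horizon S \<Longrightarrow> 0 \<le> tube p i"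
  using tube_nonneg V_dist_nonneg by (metis feasible_def)

lemma cost_nonneg: "feasible S x p \<Longrightarrow> 0 \<le> cost S p"
  using feasible_tube_nonneg[of x p "horizon S"] terminal_condition
  by (auto simp: cost_def terminal_condition_def intro!: add_nonneg_nonneg sum_nonneg stage_cost_nonneg)

text \<open>The shift follows the old nominal trajectory, extended by one step of the terminal
  controller. Only its initial tube size depends on the true system; later tubes compare by
  monotonicity of the recursion, and the terminal set and cost by their monotonicity in the tube
  size.\<close>

lemma shifted_feasible:
  assumes p: "feasible S x p"
    and q: "shifted S (F_true S x (kappa S x (xbar p 0) (ubar p 0))) p q"
  shows "feasible S (F_true S x (kappa S x (xbar p 0) (ubar p 0))) q"
    and "cost S q + stage_cost S (xbar p 0) (ubar p 0) (tube p 0) \<le> cost S p"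
proof -
  define x' where "x' = F_true S x (kappa S x (xbar p 0) (ubar p 0))"
  \<comment> \<open>Inputs \<open>i < m\<close> are copied from position \<open>Suc i\<close>; the
    last one, at \<open>m\<close>, is the terminal control at the old final state.\<close>
  obtain m where m: "horizon S = Suc m" using horizon_pos by (cases "horizon S") auto
  have rp: "recursions S p" and Vp: "V_dist S x (xbar p 0) = tube p 0"
    and cp: "\<And>i j. i < Suc m \<Longrightarrow> constr S j (xbar p i) (ubar p i) + tight S j * tube p i \<le> 0"
    and tp: "(xbar p (Suc m), tube p (Suc m)) \<in> term_set S"
    using p by (auto simp: feasible_def m)
  have rq: "recursions S q" and q0: "xbar q 0 = xbar p (Suc 0)" "tube q 0 = V_dist S x' (xbar q 0)"
    and uq: "\<And>i. i < m \<Longrightarrow> ubar q i = ubar p (Suc i)" "ubar q m = k_f S (xbar p (Suc m))"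
    using q by (auto simp: shifted_def m x'_def)
  have xq: "xbar q i = xbar p (Suc i)" if "i \<le> m" for i
    using that
  proof (induction i)
    case (Suc i)
    then show ?case
      using recursions_D(1)[OF rq, of i] recursions_D(1)[OF rp, of "Suc i"] uq(1)[of i] by (simp add: m)
  qed (rule q0)
  have tq0: "0 \<le> tube q i" if "i \<le> Suc m" for i
    using tube_nonneg[OF rq] V_dist_nonneg q0(2) that by (simp add: m)
  have tq: "tube q i \<le> tube p (Suc i)" if "i \<le> m" for i
    using that
  proof (induction i)
    case 0
    have "V_dist S x' (F_hat S (xbar p 0) (ubar p 0)) \<le> tube_next S (xbar p 0) (ubar p 0) (tube p 0)"
      unfolding x'_def Vp[symmetric] by (rule closed_loop_step) (use cp[of 0] Vp in simp)
    then show ?case using recursions_D[OF rp, of 0] q0 by (simp add: m)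
  next
    case (Suc i)
    then have "tube_next S (xbar p (Suc i)) (ubar p (Suc i)) (tube q i)
        \<le> tube_next S (xbar p (Suc i)) (ubar p (Suc i)) (tube p (Suc i))"
      by (intro tube_next_mono) simp
    then show ?case
      using recursions_D(2)[OF rq, of i] recursions_D(2)[OF rp, of "Suc i"] uq(1)[of i] xq[of i] Suc.prems
      by (simp add: m)
  qed
  let ?x = "xbar p (Suc m)" and ?d = "tube p (Suc m)"
  let ?x' = "F_hat S ?x (k_f S ?x)" and ?d' = "tube_next S ?x (k_f S ?x) ?d"
  \<comment> \<open>The new final pair is the terminal successor of the old one, up to a smaller
    tube size.\<close>
  have xqN: "xbar q (Suc m) = ?x'" and tqN: "tube q (Suc m) \<le> ?d'"
    using recursions_D[OF rq, of m] uq(2) xq[of m] tube_next_mono[OF tq[of m]] by (simp_all add: m)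
  have "constr S j (xbar q i) (ubar q i) + tight S j * tube q i \<le> 0" if "i < Suc m" for i j
  proof -
    have "tight S j * tube q i \<le> tight S j * tube p (Suc i)"
      using tq[of i] that by (intro mult_left_mono tight_nonneg) simp
    moreover have "constr S j (xbar q i) (ubar q i) + tight S j * tube p (Suc i) \<le> 0"
    proof (cases "i = m")
      case True
      then show ?thesis using terminal_D(2)[OF tp] xq[of m] uq(2) by simp
    next
      case False
      then show ?thesis using cp[of "Suc i"] xq[of i] uq(1)[of i] that by simp
    qed
    ultimately show ?thesis by linarith
  qed
  moreover have "(xbar q (Suc m), tube q (Suc m)) \<in> term_set S"
    using terminal_D(4)[OF terminal_D(1)[OF tp] tq0 tqN] xqN by simp
  ultimately show "feasible S x' q" using rq q0(2) by (simp add: feasible_def m)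
  \<comment> \<open>The new cost is compared term by term with the old plan prolonged by a terminal
    step; the decrease of \<open>l_f\<close> pays for the stage cost of that step.\<close>
  have "cost S q = (\<Sum>i<m. stage_cost S (xbar p (Suc i)) (ubar p (Suc i)) (tube q i))
      + stage_cost S ?x (k_f S ?x) (tube q m) + l_f S ?x' (tube q (Suc m))"
    using xq uq xqN by (simp add: cost_def m)
  also have "\<dots> \<le> (\<Sum>i<m. stage_cost S (xbar p (Suc i)) (ubar p (Suc i)) (tube p (Suc i)))
      + stage_cost S ?x (k_f S ?x) ?d + l_f S ?x' ?d'"
    using tq tq0 terminal_D(5)[OF terminal_D(1)[OF tp] tq0 tqN]
    by (intro add_mono sum_mono stage_cost_mono) auto
  also have "\<dots> \<le> (\<Sum>i<m. stage_cost S (xbar p (Suc i)) (ubar p (Suc i)) (tube p (Suc i))) + l_f S ?x ?d"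
    using terminal_D(3)[OF tp] by simp
  also have "\<dots> = cost S p - stage_cost S (xbar p 0) (ubar p 0) (tube p 0)"
    unfolding cost_def m by (subst sum.lessThan_Suc_shift) simp
  finally show "cost S q + stage_cost S (xbar p 0) (ubar p 0) (tube p 0) \<le> cost S p" by simp
qed

text \<open>A candidate is only ever replaced by a feasible plan of smaller cost, so suboptimality
  of the solver does no harm.\<close>

lemma alg_step_feasible:
  assumes "alg_step S x q p" "feasible S x q"
  shows "feasible S x p" "cost S p \<le> cost S q"
  using assms unfolding alg_step_def by (auto split: if_splits)

lemma closed_loop_feasible:
  assumes alg: "ALG S x p" and cl: "closed_loop S x u p"
  shows "feasible S (x k) (p k)"
    and "cost S (p (Suc k)) + stage_cost S (xbar (p k) 0) (ubar (p k) 0) (tube (p k) 0) \<le> cost S (p k)"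
proof -
  have step: "feasible S (x (Suc k)) (p (Suc k)) \<and>
      cost S (p (Suc k)) + stage_cost S (xbar (p k) 0) (ubar (p k) 0) (tube (p k) 0) \<le> cost S (p k)"
    if feas: "feasible S (x k) (p k)" for k
  proof -
    have x: "x (Suc k) = F_true S (x k) (kappa S (x k) (xbar (p k) 0) (ubar (p k) 0))"
      using cl by (simp add: closed_loop_def)
    obtain q where "shifted S (x (Suc k)) (p k) q" and q: "alg_step S (x (Suc k)) q (p (Suc k))"
      using alg by (auto simp: ALG_def)
    then show ?thesis
      using shifted_feasible[OF feas, of q] alg_step_feasible[OF q] unfolding x by auto
  qed
  have "feasible S (x k) (p k)" for k
    by (induction k) (use alg step alg_step_feasible in \<open>auto simp: ALG_def\<close>)
  then show "feasible S (x k) (p k)"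
    "cost S (p (Suc k)) + stage_cost S (xbar (p k) 0) (ubar (p k) 0) (tube (p k) 0) \<le> cost S (p k)"
    using step by blast+
qed

lemma closed_loop_convergence:
  assumes "ALG S x p" and "closed_loop S x u p"
  shows "(\<lambda>k. xbar (p k) 0) \<longlonglongrightarrow> 0" "(\<lambda>k. ubar (p k) 0) \<longlonglongrightarrow> 0" "(\<lambda>k. tube (p k) 0) \<longlonglongrightarrow> 0"
proof -
  have stage: "(\<lambda>k. stage_cost S (xbar (p k) 0) (ubar (p k) 0) (tube (p k) 0)) \<longlonglongrightarrow> 0"
    using closed_loop_feasible[OF assms] cost_nonneg
    by (intro decrease_tendsto_0[of "\<lambda>k. cost S (p k)"] stage_cost_nonneg) blast+
  \<comment> \<open>Each of the three summands lies between 0 and the vanishing stage cost.\<close>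
  note small = nonneg_summand_tendsto_0[OF stage _ stage_cost_ge(1)]
    nonneg_summand_tendsto_0[OF stage _ stage_cost_ge(2)] nonneg_summand_tendsto_0[OF stage _ stage_cost_ge(3)]
  show "(\<lambda>k. xbar (p k) 0) \<longlonglongrightarrow> 0" "(\<lambda>k. ubar (p k) 0) \<longlonglongrightarrow> 0"
    using cost_weights small(1,2) by (auto simp: cost_weights_def intro!: posdef_tendsto_0)
  have lam: "lam S > 0" using cost_weights by (simp add: cost_weights_def)
  have "(\<lambda>k. lam S * (tube (p k) 0)\<^sup>2) \<longlonglongrightarrow> 0" using small(3) lam by simp
  \<comment> \<open>Dividing by the positive weight and taking the root leaves the absolute value of
    the tube size.\<close>
  from tendsto_real_sqrt[OF tendsto_divide[OF this tendsto_const[of "lam S"]]]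
  have "(\<lambda>k. sqrt (lam S * (tube (p k) 0)\<^sup>2 / lam S)) \<longlonglongrightarrow> sqrt (0 / lam S)"
    using lam by simp
  then show "(\<lambda>k. tube (p k) 0) \<longlonglongrightarrow> 0"
    using lam by (simp add: tendsto_rabs_zero_iff)
qed

end

theorem theorem2:
  fixes S :: "('nx::{finite,linorder}, 'ne::finite, 'nu::finite, 'nc::finite, 'd::finite) mpc"
    and x :: "nat \<Rightarrow> 'nx rvec"
    and u :: "nat \<Rightarrow> 'nu rvec"
    and p :: "nat \<Rightarrow> ('nx, 'nu) plan"
  assumes "true_system S"
    and "learned_model S"
    and "geodesics S"
    and "cost_weights S"
    and "horizon S \<ge> 1"
    and "tightening_regular S"
    and "RCCM S"
    and "terminal_condition S"
    and "PEB S"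
    and "ALG S x p"
    and "closed_loop S x u p"
    and "\<exists>q. feasible S (x 0) q"
  shows "(\<forall>k. \<exists>q. feasible S (x k) q) \<and>
    (\<lambda>k. xbar (p k) 0) \<longlonglongrightarrow> 0 \<and>
    (\<lambda>k. ubar (p k) 0) \<longlonglongrightarrow> 0 \<and>
    (\<lambda>k. tube (p k) 0) \<longlonglongrightarrow> 0"
proof -
  interpret tube_mpc S by unfold_locales fact+
  show ?thesis
    using closed_loop_feasible(1)[OF \<open>ALG S x p\<close> \<open>closed_loop S x u p\<close>]
      closed_loop_convergence[OF \<open>ALG S x p\<close> \<open>closed_loop S x u p\<close>] by blast
qed

end
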